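(* Let $f$ be a probability density on $(0,+\infty)$ and let $A=(a_{jk})_{1\le j\le m,\,1\le k\le n}$ be a random complex $m\times n$ matrix whose entries are i.i.d. with density $\frac1\pi f(|a|^2)$ with respect to Lebesgue measure $d\Re a\,d\Im a$ on $\mathbb C$. Let $r\ge1$ and $t_1,\dots,t_r>0$. Define, for $y\ge0$, $$G(y)=\frac1{2\pi}\int_0^{2\pi}d\theta\int_0^{+\infty}f(x)\exp\big(2i(xy)^{1/2}\cos\theta\big)\,dx=\int_0^{+\infty}f(x)\,\phi(xy)\,dx,\qquad \phi(x)=\sum_{l=0}^{\infty}\frac{(-1)^l}{(l!)^2}x^l=J_0(2x^{1/2}),$$ where $J_0$ is the Bessel function. Then $$E\left(\prod_{l=1}^r\det(1+t_l^2A^*A)\right)^{-1}=\pi^{-r(n+m)}\int_{\mathbb R^{2r(n+m)}}\prod_{l=1}^r d^n\Re s^{(l)}\,d^n\Im s^{(l)}\,d^m\Re p^{(l)}\,d^m\Im p^{(l)}\ \exp\left(-\sum_{l=1}^r\big(|s^{(l)}|^2+|p^{(l)}|^2\big)\right)\prod_{1\le j\le m,\ 1\le k\le n}G\left(\Big|\sum_{l=1}^r t_l\,s_k^{(l)}p_j^{(l)}\Big|^2\right).$$ In the special case $r=1$, with $t=t_1>0$, this simplifies to $$E\big(\det(1+t^2A^*A)\big)^{-1}=\int_{(0,+\infty)^{m+n}}\prod_{i=1}^n e^{-u_i}\,du_i\prod_{j=1}^m e^{-v_j}\,dv_j\prod_{1\le k\le n,\ 1\le l\le m}G(t^2u_k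v_l).$$
   Context: Here $s^{(l)}=(s^{(l)}_1,\dots,s^{(l)}_n)\in\mathbb C^n$ and $p^{(l)}=(p^{(l)}_1,\dots,p^{(l)}_m)\in\mathbb C^m$ for $l=1,\dots,r$, with $|s^{(l)}|^2=\sum_k|s^{(l)}_k|^2$ and $|p^{(l)}|^2=\sum_j|p^{(l)}_j|^2$; the integration is with respect to Lebesgue measure in the real and imaginary parts of all coordinates. $A^*$ is the conjugate transpose, and $1$ inside a determinant is the identity matrix. Under the stated distribution of $A$, $f$ is the density of $|a_{jk}|^2$. *)

theory Defs
  imports "HOL-Probability.Probability"
begin

(* Only the values of f on the open half-line matter; f is otherwise arbitrary. *)
definition pos_prob_density :: "(real \<Rightarrow> real) \<Rightarrow> bool" where
  "pos_prob_density f \<longleftrightarrow>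
     (\<forall>x>0. 0 \<le> f x) \<and>
     set_integrable lborel {0<..} f \<and>
     set_lebesgue_integral lborel {0<..} f = 1"

definition conj_transpose :: "complex^'n^'m \<Rightarrow> complex^'m^'n" where
  "conj_transpose A = (\<chi> k j. cnj (A $ j $ k))"

(* Complex valued as a literal integral; its values are in fact real. *)
definition G :: "(real \<Rightarrow> real) \<Rightarrow> real \<Rightarrow> complex" where
  "G f y = of_real (1 / (2 * pi)) *
     (LBINT \<theta>:{0..2*pi}. (LBINT x:{0<..}.
        of_real (f x) * exp (2 * \<i> * of_real (sqrt (x * y) * cos \<theta>))))"

definition phi :: "real \<Rightarrow> real" where
  "phi x = (\<Sum>l. (-1)^l / (fact l)^2 * x^l)"

definition bessel_J0 :: "real \<Rightarrow> real" where
  "bessel_J0 z = (\<Sum>l. (-1)^l / (fact l)^2 * (z / 2)^(2 * l))"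

end

theory Submission
  imports Defs
begin

text \<open>
  For a fixed matrix \<open>A\<close>, a double complex Gaussian integral linearises the determinant: integrating
  \<open>exp (- |s|\<^sup>2 - |p|\<^sup>2 + 2 i t Re (\<Sum>j k. a\<^sub>j\<^sub>k s\<^sub>k p\<^sub>j))\<close> over \<open>p\<close> gives
  \<open>\<pi>\<^sup>m exp (- |s|\<^sup>2 - t\<^sup>2 |A s|\<^sup>2)\<close>, and integrating this over \<open>s\<close> gives
  \<open>\<pi>\<^sup>n\<^sup>+\<^sup>m / det (1 + t\<^sup>2 A\<^sup>* A)\<close>. The exponent is now linear in the entries of \<open>A\<close>, so after
  Fubini the expectation factorises by independence, and each factor is the characteristic function of
  a rotation-invariant law on the plane, which is \<open>G\<close>. For \<open>r = 1\<close> the integrand depends only on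
  the squared moduli of the coordinates, and squared modulus maps Lebesgue measure on the plane
  to \<open>\<pi>\<close> times Lebesgue measure on the half-line.
\<close>

subsection \<open>Lebesgue measure on vectors\<close>

text \<open>Linear changes of variables in several dimensions all rest on translation invariance:
  with the other coordinates fixed, a shear translates a single coordinate, so Fubini suffices.
  Elimination by unipotent congruences uses nothing but shears, and plane rotations factor into
  shears as well. The integral over \<open>p\<close> has to come before the one over
  \<open>s\<close>: it removes the oscillation, and what remains is a positive Gaussian in
  \<open>s\<close> that can be treated as a nonnegative integral. The factor 2 in the exponent is
  the normalisation for which \<open>exp (- x^2)\<close> and \<open>exp (- a^2)\<close> are Fourier
  transforms of each other up to \<open>sqrt pi\<close>, so that \<open>t^2\<close> enters the
  determinant without a further constant. Every exchange of expectation and integral is legitimate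
  because the phase has modulus one: the Gaussian weight alone is a joint majorant, and no moment
  condition on \<open>f\<close> enters. Two truncations recur. As \<open>f\<close> is controlled
  only on the open half-line, it is replaced by \<open>g\<close>, its product with the indicator; as
  \<open>G\<close> is evaluated through \<open>phi\<close> only at nonnegative arguments,
  measurability is read off from that integral formula instead.\<close>

lemma measurable_vec_nth [measurable]:
  "(\<lambda>x::'a::euclidean_space^'n. x $ i) \<in> borel_measurable borel"
  by (intro borel_measurable_continuous_onI continuous_intros)

lemma borel_vec_box [measurable]:
  fixes A :: "'n::finite \<Rightarrow> 'a::euclidean_space set"
  assumes "\<And>i. A i \<in> sets borel"
  shows "{x::'a^'n. \<forall>i. x $ i \<in> A i} \<in> sets borel"
proof -
  have "{x::'a^'n. \<forall>i. x $ i \<in> A i} = (\<Inter>i. (\<lambda>x. x $ i) -` A i \<inter> space borel)" by auto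
  also have "\<dots> \<in> sets borel"
    using assms by (intro sets.finite_INT measurable_sets[OF measurable_vec_nth]) auto
  finally show ?thesis .
qed

lemma measurable_vec_lambda [measurable (raw)]:
  fixes f :: "'b \<Rightarrow> 'n::finite \<Rightarrow> 'a::euclidean_space"
  assumes "\<And>i. (\<lambda>x. f x i) \<in> borel_measurable M"
  shows "(\<lambda>x. vec_lambda (f x)) \<in> borel_measurable M"
  by (rule borel_measurable_euclidean_space[THEN iffD2])
    (auto simp: Basis_vec_def inner_axis intro!: borel_measurable_inner assms)

lemma measurable_vec_lambda_PiM [measurable]:
  "vec_lambda \<in> borel_measurable (Pi\<^sub>M UNIV (\<lambda>_::'n::finite. lborel :: 'a::euclidean_space measure))"
  by (rule measurable_vec_lambda) measurable

text \<open>Every basis vector of the vector type is \<open>axis i b\<close> for exactly one pair,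
  so the volume of a box splits into the volumes of its coordinate boxes.\<close>

lemma prod_Basis_vec:
  "(\<Prod>b\<in>(Basis :: ('a::euclidean_space^'n) set). g b) = (\<Prod>i\<in>UNIV. \<Prod>b\<in>Basis. g (axis i b))"
proof -
  have "(Basis :: ('a^'n) set) = (\<lambda>(i, b). axis i b) ` (UNIV \<times> Basis)"
    by (auto simp: Basis_vec_def)
  moreover have "inj_on (\<lambda>(i::'n, b::'a). axis i b) (UNIV \<times> Basis)"
    by (auto simp: inj_on_def axis_eq_axis)
  ultimately have "prod g Basis = prod (g \<circ> (\<lambda>(i, b). axis i b)) (UNIV \<times> Basis)"
    by (metis prod.reindex)
  also have "\<dots> = (\<Prod>(i, b)\<in>UNIV \<times> Basis. g (axis i b))"
    by (auto intro: prod.cong)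
  finally have "prod g Basis = (\<Prod>(i, b)\<in>UNIV \<times> Basis. g (axis i b))" .
  then show ?thesis by (simp add: prod.cartesian_product)
qed

interpretation lborel_PiM: product_sigma_finite "\<lambda>_::'i. lborel :: 'a::euclidean_space measure"
  by standard

text \<open>Lebesgue measure is determined by the volume of boxes, and these volumes multiply. The
  identification gives access to Fubini for finite product measures.\<close>

lemma lborel_vec_eq_distr_PiM:
  "(lborel :: ('a::euclidean_space^'n) measure) = distr (Pi\<^sub>M UNIV (\<lambda>_. lborel)) borel vec_lambda"
proof (rule lborel_eqI)
  fix l u :: "'a^'n"
  assume le: "\<And>b. b \<in> Basis \<Longrightarrow> l \<bullet> b \<le> u \<bullet> b"
  have le': "l $ i \<bullet> b \<le> u $ i \<bullet> b" if "b \<in> Basis" for i b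
    using le[of "axis i b"] that by (simp add: inner_axis)
  have "vec_lambda -` box l u = Pi\<^sub>E UNIV (\<lambda>i. box (l $ i) (u $ i))"
    by (auto simp: box_def Basis_vec_def inner_axis)
  then have "emeasure (distr (Pi\<^sub>M UNIV (\<lambda>_. lborel)) borel vec_lambda) (box l u)
      = (\<Prod>i\<in>UNIV. emeasure lborel (box (l $ i) (u $ i)))"
    by (simp add: emeasure_distr space_PiM lborel_PiM.emeasure_PiM)
  also have "\<dots> = (\<Prod>i\<in>UNIV. ennreal (\<Prod>b\<in>Basis. (u $ i - l $ i) \<bullet> b))"
    using le' by simp
  also have "\<dots> = (\<Prod>b\<in>Basis. (u - l) \<bullet> b)"
    using le' by (subst prod_ennreal) (auto simp: inner_axis prod_Basis_vec inner_diff_left intro!: prod_nonneg)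
  finally show "emeasure (distr (Pi\<^sub>M UNIV (\<lambda>_. lborel)) borel vec_lambda) (box l u)
      = (\<Prod>b\<in>Basis. (u - l) \<bullet> b)" .
qed simp

text \<open>The coordinate type is left general because the formula is applied twice to arrays such
  as \<open>complex^'n^'r\<close>: once over vectors, once over their complex entries.\<close>

lemma
  fixes f :: "'n::finite \<Rightarrow> 'a::euclidean_space \<Rightarrow> 'b::{real_normed_field,banach,second_countable_topology}"
  assumes "\<And>i. integrable lborel (f i)"
  shows integrable_lborel_vec_prod: "integrable (lborel :: ('a^'n) measure) (\<lambda>x. \<Prod>i\<in>UNIV. f i (x $ i))"
    and integral_lborel_vec_prod:
      "(\<integral>x. (\<Prod>i\<in>UNIV. f i (x $ i)) \<partial>(lborel :: ('a^'n) measure)) = (\<Prod>i\<in>UNIV. integral\<^sup>L lborel (f i))"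
proof -
  have [measurable]: "f i \<in> borel_measurable borel" for i
    using assms borel_measurable_integrable by fastforce
  show "integrable (lborel :: ('a^'n) measure) (\<lambda>x. \<Prod>i\<in>UNIV. f i (x $ i))"
    unfolding lborel_vec_eq_distr_PiM using lborel_PiM.product_integrable_prod[of UNIV f] assms
    by (subst integrable_distr_eq) auto
  show "(\<integral>x. (\<Prod>i\<in>UNIV. f i (x $ i)) \<partial>(lborel :: ('a^'n) measure)) = (\<Prod>i\<in>UNIV. integral\<^sup>L lborel (f i))"
    unfolding lborel_vec_eq_distr_PiM using lborel_PiM.product_integral_prod[of UNIV f] assms
    by (subst integral_distr) auto
qed

lemma nn_integral_lborel_vec_prod:
  fixes f :: "'n::finite \<Rightarrow> 'a::euclidean_space \<Rightarrow> ennreal"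
  assumes [measurable]: "\<And>i. f i \<in> borel_measurable borel"
  shows "(\<integral>\<^sup>+x. (\<Prod>i\<in>UNIV. f i (x $ i)) \<partial>(lborel :: ('a^'n) measure)) = (\<Prod>i\<in>UNIV. integral\<^sup>N lborel (f i))"
  unfolding lborel_vec_eq_distr_PiM using lborel_PiM.product_nn_integral_prod[of UNIV f]
  by (subst nn_integral_distr) auto

lemma nn_integral_lborel_translate:
  fixes g :: "'a::euclidean_space \<Rightarrow> ennreal"
  assumes [measurable]: "g \<in> borel_measurable borel"
  shows "(\<integral>\<^sup>+x. g (x + c) \<partial>lborel) = (\<integral>\<^sup>+x. g x \<partial>lborel)"
  by (subst (2) lborel_distr_plus[symmetric, of c]) (simp add: nn_integral_distr add.commute)

text \<open>Integrate over coordinate \<open>k\<close> first: by \<open>indep\<close> the shift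
  \<open>h x\<close> is then constant, and translation invariance in one coordinate removes
  it.\<close>

lemma nn_integral_lborel_vec_shear:
  fixes g :: "'a::euclidean_space^'n \<Rightarrow> ennreal" and h :: "'a^'n \<Rightarrow> 'a"
  assumes [measurable]: "g \<in> borel_measurable borel" "h \<in> borel_measurable borel"
    and indep: "\<And>x y. (\<And>i. i \<noteq> k \<Longrightarrow> x $ i = y $ i) \<Longrightarrow> h x = h y"
  shows "(\<integral>\<^sup>+x. g (\<chi> i. if i = k then x $ k + h x else x $ i) \<partial>lborel) = (\<integral>\<^sup>+x. g x \<partial>lborel)"
proof -
  have U: "(UNIV :: 'n set) = insert k (- {k})" by auto
  \<comment> \<open>Fubini with coordinate \<open>k\<close> as the inner variable.\<close>
  have *: "(\<integral>\<^sup>+x. F x \<partial>lborel) =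
    (\<integral>\<^sup>+x. (\<integral>\<^sup>+y. F (vec_lambda (x(k := y))) \<partial>lborel) \<partial>(Pi\<^sub>M (- {k}) (\<lambda>_. lborel)))"
    if [measurable]: "F \<in> borel_measurable borel" for F :: "'a^'n \<Rightarrow> ennreal"
  proof -
    have "(\<integral>\<^sup>+x. F x \<partial>lborel) = (\<integral>\<^sup>+x. F (vec_lambda x) \<partial>Pi\<^sub>M UNIV (\<lambda>_. lborel))"
      unfolding lborel_vec_eq_distr_PiM by (subst nn_integral_distr) auto
    also have "\<dots> = (\<integral>\<^sup>+x. F (vec_lambda x) \<partial>Pi\<^sub>M (insert k (- {k})) (\<lambda>_. lborel))"
      using U by simp
    also have "\<dots> = (\<integral>\<^sup>+x. (\<integral>\<^sup>+y. F (vec_lambda (x(k := y))) \<partial>lborel) \<partial>(Pi\<^sub>M (- {k}) (\<lambda>_. lborel)))"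
    proof (rule lborel_PiM.product_nn_integral_insert)
      show "(\<lambda>x. F (vec_lambda x)) \<in> borel_measurable (Pi\<^sub>M (insert k (- {k})) (\<lambda>_. lborel))"
        unfolding U[symmetric] by measurable
    qed auto
    finally show ?thesis .
  qed
  have "(\<integral>\<^sup>+x. g (\<chi> i. if i = k then x $ k + h x else x $ i) \<partial>lborel) =
    (\<integral>\<^sup>+x. (\<integral>\<^sup>+y. g (vec_lambda (x(k := y + h (vec_lambda x)))) \<partial>lborel) \<partial>(Pi\<^sub>M (- {k}) (\<lambda>_. lborel)))"
  proof (subst *, goal_cases)
    case 2
    \<comment> \<open>Here \<open>x\<close> comes from the product over the coordinates other than
      \<open>k\<close>, so its value at \<open>k\<close> carries no information;
      \<open>indep\<close> makes the shift insensitive to it.\<close>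
    have "(\<chi> i. if i = k then vec_lambda (x(k := y)) $ k + h (vec_lambda (x(k := y))) else vec_lambda (x(k := y)) $ i)
        = vec_lambda (x(k := y + h (vec_lambda x)))" for x y
      using indep[of "vec_lambda (x(k := y))" "vec_lambda x"] by (auto simp: vec_eq_iff)
    then show ?case by simp
  qed measurable
  also have "\<dots> = (\<integral>\<^sup>+x. (\<integral>\<^sup>+y. g (vec_lambda (x(k := y))) \<partial>lborel) \<partial>(Pi\<^sub>M (- {k}) (\<lambda>_. lborel)))"
  proof (rule nn_integral_cong)
    fix x :: "'n \<Rightarrow> 'a"
    show "(\<integral>\<^sup>+y. g (vec_lambda (x(k := y + h (vec_lambda x)))) \<partial>lborel) =
        (\<integral>\<^sup>+y. g (vec_lambda (x(k := y))) \<partial>lborel)"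
      by (rule nn_integral_lborel_translate[where g="\<lambda>y. g (vec_lambda (x(k := y)))"])
        (unfold fun_upd_def, measurable)
  qed
  also have "\<dots> = (\<integral>\<^sup>+x. g x \<partial>lborel)"
    by (rule *[symmetric]) simp
  finally show ?thesis .
qed

subsection \<open>Lebesgue measure on the complex plane\<close>

lemma measurable_Complex [measurable (raw)]:
  assumes [measurable]: "f \<in> borel_measurable M" "g \<in> borel_measurable M"
  shows "(\<lambda>x. Complex (f x) (g x)) \<in> borel_measurable M"
  unfolding Complex_eq by measurable

lemma lborel_complex_eq_distr:
  "(lborel :: complex measure) = distr (lborel \<Otimes>\<^sub>M lborel) borel (\<lambda>(x, y). Complex x y)"
proof (rule lborel_eqI)
  have [measurable]: "(\<lambda>(x, y). Complex x y) \<in> borel_measurable (lborel \<Otimes>\<^sub>M lborel)"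
    unfolding Complex_eq case_prod_unfold by measurable
  fix l u :: complex
  assume le: "\<And>b. b \<in> Basis \<Longrightarrow> l \<bullet> b \<le> u \<bullet> b"
  have le': "Re l \<le> Re u" "Im l \<le> Im u"
    using le[of 1] le[of \<i>] by (auto simp: Basis_complex_def)
  have "(\<lambda>(x, y). Complex x y) -` box l u = {Re l<..<Re u} \<times> {Im l<..<Im u}"
    by (auto simp: box_def Basis_complex_def)
  then have "emeasure (distr (lborel \<Otimes>\<^sub>M lborel) borel (\<lambda>(x, y). Complex x y)) (box l u)
     = emeasure (lborel \<Otimes>\<^sub>M lborel) ({Re l<..<Re u} \<times> {Im l<..<Im u})"
    by (simp add: emeasure_distr space_pair_measure)
  also have "\<dots> = ennreal (Re u - Re l) * ennreal (Im u - Im l)"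
    using le' by (subst lborel.emeasure_pair_measure_Times) auto
  also have "\<dots> = ennreal (\<Prod>b\<in>Basis. (u - l) \<bullet> b)"
    using le' by (simp add: Basis_complex_def ennreal_mult)
  finally show "emeasure (distr (lborel \<Otimes>\<^sub>M lborel) borel (\<lambda>(x, y). Complex x y)) (box l u)
     = ennreal (\<Prod>b\<in>Basis. (u - l) \<bullet> b)" .
qed simp

text \<open>Both orders of integration are recorded because the coordinate moved by a shear has to
  be the inner variable.\<close>

lemma nn_integral_lborel_complex:
  fixes g :: "complex \<Rightarrow> ennreal"
  assumes [measurable]: "g \<in> borel_measurable borel"
  shows "(\<integral>\<^sup>+z. g z \<partial>lborel) = (\<integral>\<^sup>+x. \<integral>\<^sup>+y. g (Complex x y) \<partial>lborel \<partial>lborel)"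
    and "(\<integral>\<^sup>+z. g z \<partial>lborel) = (\<integral>\<^sup>+y. \<integral>\<^sup>+x. g (Complex x y) \<partial>lborel \<partial>lborel)"
proof -
  have m [measurable]: "(\<lambda>(x, y). Complex x y) \<in> borel_measurable (lborel \<Otimes>\<^sub>M lborel)"
    by measurable
  show *: "(\<integral>\<^sup>+z. g z \<partial>lborel) = (\<integral>\<^sup>+x. \<integral>\<^sup>+y. g (Complex x y) \<partial>lborel \<partial>lborel)"
    by (subst lborel_complex_eq_distr, subst nn_integral_distr)
      (simp_all add: lborel.nn_integral_fst[symmetric] case_prod_unfold)
  show "(\<integral>\<^sup>+z. g z \<partial>lborel) = (\<integral>\<^sup>+y. \<integral>\<^sup>+x. g (Complex x y) \<partial>lborel \<partial>lborel)"
    unfolding * by (rule lborel_pair.Fubini'[symmetric]) measurable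
qed

lemma nn_integral_complex_shear:
  fixes g :: "complex \<Rightarrow> ennreal" and c :: real
  assumes [measurable]: "g \<in> borel_measurable borel"
  shows "(\<integral>\<^sup>+z. g (Complex (Re z + c * Im z) (Im z)) \<partial>lborel) = (\<integral>\<^sup>+z. g z \<partial>lborel)"
    and "(\<integral>\<^sup>+z. g (Complex (Re z) (Im z + c * Re z)) \<partial>lborel) = (\<integral>\<^sup>+z. g z \<partial>lborel)"
proof -
  show "(\<integral>\<^sup>+z. g (Complex (Re z + c * Im z) (Im z)) \<partial>lborel) = (\<integral>\<^sup>+z. g z \<partial>lborel)"
    by (simp add: nn_integral_lborel_complex(2) nn_integral_lborel_translate[where g="\<lambda>x. g (Complex x _)"])
  show "(\<integral>\<^sup>+z. g (Complex (Re z) (Im z + c * Re z)) \<partial>lborel) = (\<integral>\<^sup>+z. g z \<partial>lborel)"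
    by (simp add: nn_integral_lborel_complex(1) nn_integral_lborel_translate[where g="\<lambda>y. g (Complex _ y)"])
qed

text \<open>A rotation other than \<^term>\<open>-1\<close> is a product of three shears.\<close>
lemma nn_integral_complex_rotate:
  fixes g :: "complex \<Rightarrow> ennreal"
  assumes [measurable]: "g \<in> borel_measurable borel" and w: "cmod w = 1"
  shows "(\<integral>\<^sup>+z. g (w * z) \<partial>lborel) = (\<integral>\<^sup>+z. g z \<partial>lborel)"
proof -
  have main: "(\<integral>\<^sup>+z. h (w * z) \<partial>lborel) = (\<integral>\<^sup>+z. h z \<partial>lborel)"
    if [measurable]: "h \<in> borel_measurable borel" and w: "cmod w = 1" and n: "Re w \<noteq> -1"
    for h :: "complex \<Rightarrow> ennreal" and w
  proof -
    \<comment> \<open>For \<open>w = cis \<theta>\<close> these are \<open>s = sin \<theta>\<close>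
      and \<open>t = - tan (\<theta> / 2)\<close>, the parameters in the factorisation of a rotation
      into a horizontal, a vertical and again a horizontal shear. The matrix identity amounts to
      \<open>st\<close> and \<open>tst\<close>.\<close>
    define s where "s = Im w"
    define t where "t = - (Im w / (1 + Re w))"
    have n': "1 + Re w \<noteq> 0" using n by linarith
    have r: "(Re w)\<^sup>2 + (Im w)\<^sup>2 = 1" using w by (simp add: cmod_def)
    have t: "t * (1 + Re w) = - Im w" using n' by (simp add: t_def)
    have "s * t * (1 + Re w) = (Re w - 1) * (1 + Re w)"
      unfolding mult.assoc t using r by (simp add: s_def power2_eq_square algebra_simps)
    then have st: "s * t = Re w - 1" using n' by simp
    have "(2 * t + t * (s * t)) * (1 + Re w) = (1 + Re w) * (t * (1 + Re w))"
      unfolding st by (simp add: algebra_simps)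
    also have "\<dots> = - s * (1 + Re w)" unfolding t by (simp add: s_def)
    finally have "(2 * t + t * (s * t)) * (1 + Re w) = - s * (1 + Re w)" .
    then have tst: "2 * t + t * (s * t) = - s" using n' by (metis mult_right_cancel)
    define h1 where "h1 z = h (Complex (Re z + t * Im z) (Im z))" for z
    define h2 where "h2 z = h1 (Complex (Re z) (Im z + s * Re z))" for z
    have [measurable]: "h1 \<in> borel_measurable borel" "h2 \<in> borel_measurable borel"
      unfolding h1_def h2_def by measurable
    have eq: "h (w * z) = h2 (Complex (Re z + t * Im z) (Im z))" for z
    proof -
      have "Re z + t * Im z + t * (Im z + s * (Re z + t * Im z))
          = (1 + s * t) * Re z + (2 * t + t * (s * t)) * Im z"
        by (simp add: algebra_simps)
      also have "\<dots> = Re (w * z)" unfolding tst unfolding st by (simp add: s_def)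
      finally have 1: "Re z + t * Im z + t * (Im z + s * (Re z + t * Im z)) = Re (w * z)" .
      have "Im z + s * (Re z + t * Im z) = s * Re z + (1 + s * t) * Im z"
        by (simp add: algebra_simps)
      also have "\<dots> = Im (w * z)" unfolding st by (simp add: s_def)
      finally have 2: "Im z + s * (Re z + t * Im z) = Im (w * z)" .
      show ?thesis
        using 1 by (simp only: h1_def h2_def complex.sel 2 complex_surj)
    qed
    have "(\<integral>\<^sup>+z. h (w * z) \<partial>lborel) = (\<integral>\<^sup>+z. h2 z \<partial>lborel)"
      unfolding eq by (rule nn_integral_complex_shear(1)) measurable
    also have "\<dots> = (\<integral>\<^sup>+z. h1 z \<partial>lborel)"
      unfolding h2_def by (rule nn_integral_complex_shear(2)) measurable
    also have "\<dots> = (\<integral>\<^sup>+z. h z \<partial>lborel)"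
      unfolding h1_def by (rule nn_integral_complex_shear(1)) measurable
    finally show ?thesis .
  qed
  show ?thesis
  proof (cases "Re w = -1")
    case False
    then show ?thesis using main assms by blast
  next
    case True
    with w have "Im w = 0" by (simp add: cmod_def power2_eq_square real_sqrt_eq_1_iff)
    \<comment> \<open>The half turn, for which \<open>tan (\<theta> / 2)\<close> is infinite, is two
      quarter turns.\<close>
    with True have "w = \<i> * \<i>" by (simp add: complex_eq_iff)
    then have "(\<integral>\<^sup>+z. g (w * z) \<partial>lborel) = (\<integral>\<^sup>+z. g (\<i> * (\<i> * z)) \<partial>lborel)"
      by (simp only: mult.assoc)
    also have "\<dots> = (\<integral>\<^sup>+z. g (\<i> * z) \<partial>lborel)"
      by (rule main[where h="\<lambda>z. g (\<i> * z)"]) auto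
    also have "\<dots> = (\<integral>\<^sup>+z. g z \<partial>lborel)"
      by (rule main) auto
    finally show ?thesis .
  qed
qed

lemma distr_lborel_rotate:
  assumes "cmod w = 1"
  shows "distr lborel borel (\<lambda>z. w * z) = (lborel :: complex measure)"
proof (rule measure_eqI)
  fix X assume "X \<in> sets (distr lborel borel (\<lambda>z. w * z))"
  then have [measurable]: "X \<in> sets borel" by simp
  have "emeasure (distr lborel borel (\<lambda>z. w * z)) X = (\<integral>\<^sup>+z. indicator X z \<partial>distr lborel borel (\<lambda>z. w * z))"
    by simp
  also have "\<dots> = (\<integral>\<^sup>+z. indicator X (w * z) \<partial>lborel)"
    by (rule nn_integral_distr) measurable
  also have "\<dots> = emeasure lborel X"
    using nn_integral_complex_rotate[of "indicator X" w] assms by simp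
  finally show "emeasure (distr lborel borel (\<lambda>z. w * z)) X = emeasure lborel X" .
qed simp

text \<open>A disc of squared radius \<open>r\<close> has area \<open>pi * r\<close>. This is linear
  in \<open>r\<close>, whence the constant density \<open>pi\<close> on the half-line.\<close>

lemma distr_lborel_cmod_square:
  "distr (lborel :: complex measure) borel (\<lambda>z. (cmod z)\<^sup>2) = density lborel (\<lambda>x. pi * indicator {0<..} x)"
proof -
  \<comment> \<open>The reflection makes the rays \<open>{x<..}\<close> have finite measure, which the uniqueness lemma requires.\<close>
  have "distr (lborel :: complex measure) borel (\<lambda>z. - ((cmod z)\<^sup>2))
      = distr (density lborel (\<lambda>x. pi * indicator {0<..} x)) borel uminus"
    (is "?L = ?R")
  proof (rule measure_eqI_lessThan)
    fix x :: real
    have L: "emeasure ?L {x<..} = ennreal (pi * max 0 (- x))"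
    proof (cases "x < 0")
      case True
      have "x < - ((cmod z)\<^sup>2) \<longleftrightarrow> cmod z < sqrt (- x)" for z
        using real_sqrt_less_iff[of "(cmod z)\<^sup>2" "- x"] by simp linarith
      then have "(\<lambda>z. - ((cmod z)\<^sup>2)) -` {x<..} = ball 0 (sqrt (- x))"
        by (simp add: set_eq_iff)
      then have "emeasure ?L {x<..} = emeasure lborel (ball (0::complex) (sqrt (- x)))"
        by (simp add: emeasure_distr)
      also have "\<dots> = ennreal (pi * max 0 (- x))"
        using True by (subst emeasure_ball) (auto simp: unit_ball_vol_2)
      finally show ?thesis .
    next
      case False
      have "\<not> x < - ((cmod z)\<^sup>2)" for z
        using False zero_le_power2[of "cmod z"] by linarith
      then have "(\<lambda>z::complex. - ((cmod z)\<^sup>2)) -` {x<..} = {}"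
        by (simp add: set_eq_iff)
      then show ?thesis using False by (simp add: emeasure_distr)
    qed
    have "uminus -` {x<..} = {..<- x}" by auto
    then have "emeasure ?R {x<..} = emeasure (density lborel (\<lambda>x. ennreal (pi * indicator {0<..} x))) {..<- x}"
      by (simp add: emeasure_distr)
    also have "\<dots> = (\<integral>\<^sup>+y. ennreal (pi * indicator {0<..} y) * indicator {..<- x} y \<partial>lborel)"
      by (subst emeasure_density) auto
    also have "\<dots> = (\<integral>\<^sup>+y. ennreal pi * indicator {0<..<-x} y \<partial>lborel)"
      by (intro nn_integral_cong) (auto simp: indicator_def)
    also have "\<dots> = ennreal (pi * max 0 (- x))"
      by (cases "x < 0") (auto simp: nn_integral_cmult ennreal_mult'[symmetric])
    finally show "emeasure ?L {x<..} = emeasure ?R {x<..}" using L by simp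
    show "emeasure ?L {x<..} < \<infinity>" unfolding L by simp
  qed auto
  then have "distr ?L borel uminus = distr ?R borel uminus" by simp
  then show ?thesis
    by (subst (asm) (1 2) distr_distr) (simp_all add: o_def distr_id2)
qed

lemma nn_integral_cmod_square:
  fixes g :: "real \<Rightarrow> ennreal"
  assumes [measurable]: "g \<in> borel_measurable borel"
  shows "(\<integral>\<^sup>+z. g ((cmod z)\<^sup>2) \<partial>lborel) = (\<integral>\<^sup>+x. pi * indicator {0<..} x * g x \<partial>lborel)"
proof -
  have "(\<integral>\<^sup>+z. g ((cmod z)\<^sup>2) \<partial>lborel) = (\<integral>\<^sup>+x. g x \<partial>distr (lborel :: complex measure) borel (\<lambda>z. (cmod z)\<^sup>2))"
    by (subst nn_integral_distr) auto
  then show ?thesis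
    unfolding distr_lborel_cmod_square by (subst (asm) nn_integral_density) auto
qed

text \<open>In the variable \<open>x = (cmod z)^2\<close> the integrand becomes
  \<open>pi / c\<close> times the density of the exponential law, whose total mass is 1.\<close>

lemma nn_integral_complex_gaussian:
  assumes c: "0 < c"
  shows "(\<integral>\<^sup>+z. ennreal (exp (- c * (cmod z)\<^sup>2)) \<partial>lborel) = ennreal (pi / c)"
proof -
  interpret E: prob_space "density lborel (exponential_density c)"
    by (rule prob_space_exponential_density[OF c])
  have "1 = emeasure (density lborel (exponential_density c)) UNIV"
    using E.emeasure_space_1 by simp
  also have "\<dots> = (\<integral>\<^sup>+x. ennreal (exponential_density c x) \<partial>lborel)"
    by (simp add: emeasure_density)
  finally have 1: "(\<integral>\<^sup>+x. ennreal (exponential_density c x) \<partial>lborel) = 1" ..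
  have "(\<integral>\<^sup>+z. ennreal (exp (- c * (cmod z)\<^sup>2)) \<partial>lborel)
      = (\<integral>\<^sup>+x. pi * indicator {0<..} x * ennreal (exp (- c * x)) \<partial>lborel)"
    by (rule nn_integral_cmod_square) measurable
  also have "\<dots> = (\<integral>\<^sup>+x. ennreal (pi / c) * ennreal (exponential_density c x) \<partial>lborel)"
  proof (rule nn_integral_cong_AE)
    show "AE x in lborel. pi * indicator {0<..} x * ennreal (exp (- c * x)) =
        ennreal (pi / c) * ennreal (exponential_density c x)"
      \<comment> \<open>The two integrands differ at the origin, where
        \<open>exponential_density\<close> is positive but the indicator of the open half-line
        vanishes.\<close>
      using AE_lborel_singleton[of 0]
      by eventually_elim
        (use c in \<open>auto simp: indicator_def exponential_density_def ennreal_mult'[symmetric] mult.commute\<close>)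
  qed
  also have "\<dots> = ennreal (pi / c)"
    by (subst nn_integral_cmult) (auto simp: 1)
  finally show ?thesis .
qed

subsection \<open>Gaussian integrals and determinants\<close>

lemma conj_transpose_nth [simp]: "conj_transpose A $ i $ j = cnj (A $ j $ i)"
  by (simp add: conj_transpose_def)

lemma det_conj_transpose: "det (conj_transpose A) = cnj (det A)"
proof -
  have "conj_transpose A = transpose (\<chi> i j. cnj (A $ i $ j))"
    by (simp add: vec_eq_iff transpose_def)
  then have "det (conj_transpose A) = det (\<chi> i j. cnj (A $ i $ j))"
    by (simp add: det_transpose)
  then show ?thesis by (simp add: det_def)
qed

lemma conj_transpose_adjoint:
  "(\<Sum>k\<in>UNIV. cnj (s $ k) * (conj_transpose A *v x) $ k) = (\<Sum>j\<in>UNIV. cnj ((A *v s) $ j) * x $ j)"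
  unfolding matrix_vector_mult_def
  by (simp add: sum_distrib_left sum_distrib_right, subst sum.swap) (simp add: mult_ac)

definition quad_form :: "complex^'n^'n \<Rightarrow> complex^'n \<Rightarrow> complex" where
  "quad_form H s = (\<Sum>k\<in>UNIV. cnj (s $ k) * (H *v s) $ k)"

lemma quad_form_congruence:
  "quad_form (conj_transpose L ** H ** L) s = quad_form H (L *v s)"
  by (simp add: quad_form_def matrix_vector_mul_assoc[symmetric] conj_transpose_adjoint)

text \<open>Since only the real part of the form is constrained, positivity would not force
  \<open>H\<close> to be Hermitian; this is why symmetry is a separate clause.\<close>

definition pos_def_hermitian :: "complex^'n^'n \<Rightarrow> bool" where
  "pos_def_hermitian H \<longleftrightarrow> conj_transpose H = H \<and> (\<forall>s. s \<noteq> 0 \<longrightarrow> 0 < Re (quad_form H s))"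

text \<open>Evaluating the form at unit vectors shows that the diagonal entries of a positive
  definite matrix are positive, so they can serve as pivots.\<close>

lemma quad_form_axis: "quad_form H (axis k 1) = H $ k $ k"
  by (simp add: quad_form_def matrix_vector_mult_def axis_def if_distrib[of cnj] if_distrib[of "\<lambda>x. x * _"]
      if_distrib[of "\<lambda>x. _ * x"] cong: if_cong)

lemma pos_def_hermitian_diag:
  assumes "pos_def_hermitian H"
  shows "0 < Re (H $ k $ k)" "H $ k $ k = of_real (Re (H $ k $ k))"
proof -
  show "0 < Re (H $ k $ k)"
    using assms quad_form_axis[of H k] by (metis axis_eq_0_iff pos_def_hermitian_def zero_neq_one)
  have "cnj (H $ k $ k) = H $ k $ k"
    using assms by (metis conj_transpose_nth pos_def_hermitian_def)
  then show "H $ k $ k = of_real (Re (H $ k $ k))"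
    by (simp add: complex_eq_iff)
qed

lemma measurable_quad_form [measurable]: "quad_form H \<in> borel_measurable borel"
  unfolding quad_form_def matrix_vector_mult_def vec_lambda_beta
  by (intro borel_measurable_continuous_onI continuous_intros)

text \<open>Completing the square in one coordinate at a time turns \<open>H\<close> into a diagonal matrix by
  congruences with shears, which change neither the integral nor the determinant.\<close>
lemma nn_integral_gaussian_quad_form:
  fixes H :: "complex^'n^'n"
  assumes "pos_def_hermitian H"
  obtains d where "0 < d" "det H = of_real d"
    "(\<integral>\<^sup>+s. ennreal (exp (- Re (quad_form H s))) \<partial>lborel) = ennreal (pi ^ CARD('n) / d)"
proof -
  \<comment> \<open>\<open>S\<close> collects the coordinates not yet decoupled. Outside
    \<open>S\<close> the off-diagonal part of each row is zero, hence by symmetry that of each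
    column; the induction starts with a diagonal matrix and ends with an arbitrary one at
    \<open>S = UNIV\<close>.\<close>
  have *: "\<exists>d>0. det H = of_real d \<and>
      (\<integral>\<^sup>+s. ennreal (exp (- Re (quad_form H s))) \<partial>lborel) = ennreal (pi ^ CARD('n) / d)"
    if "finite S" "pos_def_hermitian H" "\<forall>k j. k \<notin> S \<longrightarrow> j \<noteq> k \<longrightarrow> H $ k $ j = 0" for S and H :: "complex^'n^'n"
    using that
  proof (induction S arbitrary: H rule: finite_induct)
    case empty
    define h where "h k = Re (H $ k $ k)" for k
    have h: "0 < h k" "H $ k $ k = of_real (h k)" for k
      using pos_def_hermitian_diag[OF empty(1)] by (auto simp: h_def)
    have off: "H $ k $ j = (if j = k then of_real (h k) else 0)" for k j
      using empty(2) h by auto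
    have det: "det H = of_real (\<Prod>k\<in>UNIV. h k)"
      using empty(2) by (subst det_diagonal) (auto simp: h)
    have Hv: "(H *v s) $ k = of_real (h k) * s $ k" for s k
      by (simp add: matrix_vector_mult_def off if_distrib[of "\<lambda>x. x * _"] cong: if_cong)
    have nq: "cnj (s $ k) * (of_real (h k) * s $ k) = of_real (h k * (cmod (s $ k))\<^sup>2)" for s :: "complex^'n" and k
      by (simp add: complex_norm_square mult_ac del: of_real_power)
    have "Re (quad_form H s) = (\<Sum>k\<in>UNIV. h k * (cmod (s $ k))\<^sup>2)" for s
      by (simp only: quad_form_def Hv nq Re_sum Re_complex_of_real)
    then have "(\<integral>\<^sup>+s. ennreal (exp (- Re (quad_form H s))) \<partial>lborel)
        = (\<integral>\<^sup>+s. (\<Prod>k\<in>UNIV. ennreal (exp (- h k * (cmod (s $ k))\<^sup>2))) \<partial>lborel)"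
      by (simp add: prod_ennreal exp_sum sum_negf[symmetric])
    also have "\<dots> = (\<Prod>k\<in>UNIV. ennreal (pi / h k))"
      by (subst nn_integral_lborel_vec_prod) (use h in \<open>auto simp only: nn_integral_complex_gaussian intro!: prod.cong\<close>, measurable)
    also have "\<dots> = ennreal (pi ^ CARD('n) / (\<Prod>k\<in>UNIV. h k))"
      using h by (subst prod_ennreal) (auto simp: prod_dividef intro: less_imp_le)
    finally show ?case using det h by (intro exI[of _ "\<Prod>k\<in>UNIV. h k"]) (auto intro: prod_pos)
  next
    case (insert k S)
    let ?h = "H $ k $ k"
    have h0: "?h \<noteq> 0"
      using pos_def_hermitian_diag[OF insert.prems(1), of k] by auto
    have herm: "cnj (H $ i $ j) = H $ j $ i" for i j
      using insert.prems(1) by (metis conj_transpose_nth pos_def_hermitian_def)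
    \<comment> \<open>Replacing \<open>s $ k\<close> by
      \<open>s $ k + (\<Sum>j. c j * s $ j)\<close> completes the square in coordinate
      \<open>k\<close> and cancels its cross terms. Setting \<open>c k = 0\<close> makes
      \<open>L\<close> unipotent and the shift independent of \<open>s $ k\<close>, as the shear
      lemma requires.\<close>
    define c where "c j = (if j = k then 0 else - (H $ k $ j / ?h))" for j
    define L :: "complex^'n^'n" where "L = (\<chi> i j. (if i = j then 1 else 0) + (if i = k then c j else 0))"
    have XL: "(X ** L) $ i $ j = X $ i $ j + X $ i $ k * c j" for X :: "complex^'n^'n" and i j
      by (simp add: matrix_matrix_mult_def L_def distrib_left sum.distrib if_distrib[of "\<lambda>x. _ * x"] cong: if_cong)
    have LX: "(conj_transpose L ** X) $ i $ j = X $ i $ j + cnj (c i) * X $ k $ j" for X :: "complex^'n^'n" and i j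
      by (simp add: matrix_matrix_mult_def L_def distrib_right sum.distrib if_distrib[of "\<lambda>x. x * _"]
          if_distrib[of cnj] cong: if_cong)
    define H' where "H' = conj_transpose L ** H ** L"
    have H'_eq: "H' $ i $ j = (H ** L) $ i $ j + cnj (c i) * (H ** L) $ k $ j" for i j
      unfolding H'_def matrix_mul_assoc[symmetric] LX ..
    have Lv: "L *v s = (\<chi> i. if i = k then s $ k + (\<Sum>j\<in>UNIV. c j * s $ j) else s $ i)" for s
      by (auto simp: vec_eq_iff matrix_vector_mult_def L_def distrib_right sum.distrib if_distrib[of "\<lambda>x. x * _"] cong: if_cong)
    have detL: "det L = 1"
    proof -
      \<comment> \<open>\<open>L\<close> is the identity matrix with a combination of the other rows
        added to row \<open>k\<close>, which leaves the determinant at 1.\<close>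
      let ?x = "\<Sum>j\<in>UNIV - {k}. c j *s row j (mat 1 :: complex^'n^'n)"
      have "?x \<in> vec.span {row j (mat 1) | j. j \<noteq> k}"
        by (intro vec.span_sum vec.span_scale vec.span_base) auto
      then have "det (\<chi> i. if i = k then row k (mat 1) + ?x else row i (mat 1)) = det (mat 1 :: complex^'n^'n)"
        by (rule det_row_span)
      also have "(\<chi> i. if i = k then row k (mat 1) + ?x else row i (mat 1)) = L"
      proof -
        have "?x $ j = c j" for j
        proof -
          have "?x $ j = (\<Sum>i\<in>UNIV - {k}. if i = j then c i else 0)"
            unfolding sum_component by (intro sum.cong) (auto simp: row_def mat_def)
          also have "\<dots> = c j" by (subst sum.delta) (auto simp: c_def)
          finally show ?thesis .
        qed
        then show ?thesis by (simp add: vec_eq_iff L_def row_def mat_def)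
      qed
      finally show ?thesis by simp
    qed
    have detH': "det H' = det H"
      by (simp add: H'_def det_mul det_conj_transpose detL)
    have qf: "quad_form H' s = quad_form H (L *v s)" for s
      by (simp add: H'_def quad_form_congruence)
    have "pos_def_hermitian H'"
      unfolding pos_def_hermitian_def
    proof (intro conjI allI impI)
      show "conj_transpose H' = H'"
        by (simp add: vec_eq_iff H'_eq XL herm algebra_simps)
      fix s :: "complex^'n" assume s: "s \<noteq> 0"
      have "L *v s \<noteq> 0"
      proof
        assume "L *v s = 0"
        moreover have "invertible L" by (simp add: invertible_det_nz detL)
        ultimately have "s = 0"
          by (metis invertible_def matrix_vector_mul_assoc matrix_vector_mul_lid matrix_vector_mult_0_right)
        with s show False ..
      qed
      then show "0 < Re (quad_form H' s)"
        using insert.prems(1) by (simp add: qf pos_def_hermitian_def)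
    qed
    \<comment> \<open>Row \<open>k\<close> is cleared by the choice of \<open>c\<close>. A row
      \<open>l\<close> cleared earlier stays clear: there \<open>H $ l $ k = 0\<close>, so
      \<open>H $ k $ l = 0\<close> by symmetry and \<open>c l = 0\<close>.\<close>
    moreover have "H' $ l $ j = 0" if "l \<notin> S" "j \<noteq> l" for l j
    proof (cases "l = k")
      case True
      with that h0 show ?thesis by (simp add: H'_eq XL c_def)
    next
      case False
      with that have z: "H $ l $ i = 0" if "i \<noteq> l" for i
        using insert.prems(2) that by auto
      from z[of k] herm[of l k] False have "H $ k $ l = 0" by auto
      then show ?thesis
        using z that False by (simp add: H'_eq XL c_def)
    qed
    ultimately obtain d where d: "0 < d" "det H' = of_real d"
      "(\<integral>\<^sup>+s. ennreal (exp (- Re (quad_form H' s))) \<partial>lborel) = ennreal (pi ^ CARD('n) / d)"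
      using insert.IH[of H'] by blast
    have "(\<integral>\<^sup>+s. ennreal (exp (- Re (quad_form H' s))) \<partial>lborel)
        = (\<integral>\<^sup>+s. ennreal (exp (- Re (quad_form H s))) \<partial>lborel)"
      unfolding qf Lv
    proof (rule nn_integral_lborel_vec_shear[where g="\<lambda>s. ennreal (exp (- Re (quad_form H s)))"])
      fix x y :: "complex^'n"
      assume "\<And>i. i \<noteq> k \<Longrightarrow> x $ i = y $ i"
      then show "(\<Sum>j\<in>UNIV. c j * x $ j) = (\<Sum>j\<in>UNIV. c j * y $ j)"
        by (intro sum.cong) (auto simp: c_def)
    qed measurable
    with d detH' show ?case by auto
  qed
  from *[of UNIV H] assms that show thesis by auto
qed

lemma quad_form_one_plus_gram:
  fixes A :: "complex^'n^'m"
  shows "quad_form (mat 1 + t\<^sup>2 *\<^sub>R (conj_transpose A ** A)) s = of_real ((norm s)\<^sup>2 + t\<^sup>2 * (norm (A *v s))\<^sup>2)"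
proof -
  have sq: "(\<Sum>k\<in>UNIV. cnj (x $ k) * x $ k) = of_real ((norm x)\<^sup>2)" for x :: "complex^'a"
    by (simp add: norm_vec_def L2_set_def sum_nonneg complex_norm_square mult.commute del: of_real_power)
  have "(mat 1 + t\<^sup>2 *\<^sub>R (conj_transpose A ** A)) *v s = s + t\<^sup>2 *\<^sub>R (conj_transpose A *v (A *v s))"
    by (simp add: matrix_vector_mult_add_rdistrib matrix_vector_mul_assoc)
      (simp add: vec_eq_iff matrix_vector_mult_def scaleR_sum_right)
  then have "quad_form (mat 1 + t\<^sup>2 *\<^sub>R (conj_transpose A ** A)) s
      = (\<Sum>k\<in>UNIV. cnj (s $ k) * s $ k) + t\<^sup>2 *\<^sub>R (\<Sum>k\<in>UNIV. cnj (s $ k) * (conj_transpose A *v (A *v s)) $ k)"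
    by (simp add: quad_form_def distrib_left sum.distrib scaleR_sum_right)
  then show ?thesis
    unfolding conj_transpose_adjoint sq by (simp add: scaleR_conv_of_real)
qed

text \<open>The term \<open>(norm s)^2\<close> alone makes the form positive definite. The witness
  \<open>d\<close> records that the complex-valued determinant is a positive real, so that its
  inverse is meaningful.\<close>

lemma nn_integral_gaussian_one_plus_gram:
  fixes A :: "complex^'n^'m"
  obtains d where "0 < d" "det (mat 1 + t\<^sup>2 *\<^sub>R (conj_transpose A ** A)) = of_real d"
    "(\<integral>\<^sup>+s. ennreal (exp (- ((norm s)\<^sup>2 + t\<^sup>2 * (norm (A *v s))\<^sup>2))) \<partial>lborel) = ennreal (pi ^ CARD('n) / d)"
proof -
  have "pos_def_hermitian (mat 1 + t\<^sup>2 *\<^sub>R (conj_transpose A ** A))"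
    unfolding pos_def_hermitian_def
  proof (intro conjI allI impI)
    show "conj_transpose (mat 1 + t\<^sup>2 *\<^sub>R (conj_transpose A ** A)) = mat 1 + t\<^sup>2 *\<^sub>R (conj_transpose A ** A)"
      by (auto simp: vec_eq_iff mat_def matrix_matrix_mult_def mult.commute)
    show "0 < Re (quad_form (mat 1 + t\<^sup>2 *\<^sub>R (conj_transpose A ** A)) s)" if "s \<noteq> 0" for s
      using that by (auto simp: quad_form_one_plus_gram intro!: add_pos_nonneg)
  qed
  from nn_integral_gaussian_quad_form[OF this] that show thesis
    by (auto simp: quad_form_one_plus_gram)
qed

section \<open>Fourier transforms of Gaussians on the line and in the plane\<close>

lemma integrable_pair_mult:
  fixes f :: "'a \<Rightarrow> real" and g :: "'b \<Rightarrow> real"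
  assumes "sigma_finite_measure M" "sigma_finite_measure N" and f: "integrable M f" and g: "integrable N g"
  shows "integrable (M \<Otimes>\<^sub>M N) (\<lambda>(x, y). f x * g y)"
proof -
  interpret pair_sigma_finite M N using assms by (simp add: pair_sigma_finite_def)
  have [measurable]: "f \<in> borel_measurable M" "g \<in> borel_measurable N" using f g by auto
  show ?thesis
  proof (rule Fubini_integrable)
    show "integrable M (\<lambda>x. \<integral>y. norm (case (x, y) of (x, y) \<Rightarrow> f x * g y) \<partial>N)"
      using f by (simp add: abs_mult)
    show "AE x in M. integrable N (\<lambda>y. case (x, y) of (x, y) \<Rightarrow> f x * g y)"
      using g by simp
  qed measurable
qed

text \<open>This is the characteristic function \<open>exp (- u^2 / 2)\<close> of the standard
  normal law at \<open>u = sqrt 2 * a\<close>, rescaled by \<open>sqrt 2\<close> in the integration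
  variable.\<close>

lemma
  fixes a :: real
  shows integrable_gaussian_character:
      "integrable lborel (\<lambda>x. of_real (exp (- x\<^sup>2)) * exp (2 * \<i> * of_real (x * a)))"
    and integral_gaussian_character:
      "(\<integral>x. of_real (exp (- x\<^sup>2)) * exp (2 * \<i> * of_real (x * a)) \<partial>lborel) = of_real (sqrt pi * exp (- a\<^sup>2))"
proof -
  define F :: "real \<Rightarrow> complex" where "F x = std_normal_density x *\<^sub>R iexp (sqrt 2 * a * x)" for x
  have int: "integrable lborel F"
    unfolding F_def
    by (rule Bochner_Integration.integrable_bound[OF integrable_normal_density[of 1 0]]) auto
  \<comment> \<open>The summand \<open>0\<close> only gives the argument the affine shape that the
    substitution rule expects.\<close>
  have eq: "of_real (exp (- x\<^sup>2)) * exp (2 * \<i> * of_real (x * a)) = of_real (sqrt (2 * pi)) * F (0 + sqrt 2 * x)" for x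
  proof -
    have "sqrt 2 * a * (sqrt 2 * x) = 2 * (x * a)" by simp
    then show ?thesis
      by (simp add: F_def std_normal_density_def scaleR_conv_of_real power_mult_distrib mult_ac)
  qed
  show "integrable lborel (\<lambda>x. of_real (exp (- x\<^sup>2)) * exp (2 * \<i> * of_real (x * a)))"
    unfolding eq by (intro integrable_mult_right lborel_integrable_real_affine int) auto
  have "of_real (exp (- a\<^sup>2)) = char std_normal_distribution (sqrt 2 * a)"
    by (simp add: char_std_normal_distribution power_mult_distrib)
  also have "\<dots> = integral\<^sup>L lborel F"
    unfolding char_def F_def by (subst integral_density) (auto simp: mult_ac)
  also have "\<dots> = sqrt 2 *\<^sub>R (\<integral>x. F (0 + sqrt 2 * x) \<partial>lborel)"
    by (subst lborel_integral_real_affine[where c="sqrt 2" and t=0]) auto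
  finally have *: "complex_of_real (exp (- a\<^sup>2)) = sqrt 2 *\<^sub>R (\<integral>x. F (0 + sqrt 2 * x) \<partial>lborel)" .
  have "(\<integral>x. of_real (exp (- x\<^sup>2)) * exp (2 * \<i> * of_real (x * a)) \<partial>lborel)
      = of_real (sqrt (2 * pi)) * (\<integral>x. F (0 + sqrt 2 * x) \<partial>lborel)"
    unfolding eq by (rule integral_mult_right_zero)
  also have "\<dots> = of_real (sqrt pi) * (sqrt 2 *\<^sub>R (\<integral>x. F (0 + sqrt 2 * x) \<partial>lborel))"
    by (simp add: real_sqrt_mult scaleR_conv_of_real)
  finally show "(\<integral>x. of_real (exp (- x\<^sup>2)) * exp (2 * \<i> * of_real (x * a)) \<partial>lborel) = of_real (sqrt pi * exp (- a\<^sup>2))"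
    unfolding *[symmetric] by simp
qed

lemma
  fixes w :: complex
  shows integrable_complex_gaussian_character:
      "integrable lborel (\<lambda>z. of_real (exp (- (cmod z)\<^sup>2)) * exp (2 * \<i> * of_real (Re (z * w))))"
    and integral_complex_gaussian_character:
      "(\<integral>z. of_real (exp (- (cmod z)\<^sup>2)) * exp (2 * \<i> * of_real (Re (z * w))) \<partial>lborel)
        = of_real (pi * exp (- (cmod w)\<^sup>2))"
proof -
  define e where "e a x = complex_of_real (exp (- x\<^sup>2)) * exp (2 * \<i> * of_real (x * a))" for a x :: real
  define F where "F z = of_real (exp (- (cmod z)\<^sup>2)) * exp (2 * \<i> * of_real (Re (z * w)))" for z
  have [measurable]: "F \<in> borel_measurable borel"
    unfolding F_def by measurable
  \<comment> \<open>The pairing \<open>Re (z * w)\<close> has no conjugation, so the imaginary part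
    of \<open>w\<close> enters with a minus sign, which the even Gaussian then absorbs.\<close>
  have eq: "F (Complex x y) = e (Re w) x * e (- Im w) y" for x y
    by (simp add: F_def e_def cmod_power2 exp_add[symmetric] exp_of_real[symmetric] algebra_simps)
  have int: "integrable lborel (e a)" for a
    unfolding e_def by (rule integrable_gaussian_character)
  have inte: "integral\<^sup>L lborel (e a) = of_real (sqrt pi * exp (- a\<^sup>2))" for a
    unfolding e_def by (rule integral_gaussian_character)
  have m [measurable]: "(\<lambda>(x, y). Complex x y) \<in> borel_measurable (lborel \<Otimes>\<^sub>M lborel)"
    by measurable
  have [measurable]: "e a \<in> borel_measurable borel" for a
    unfolding e_def by measurable
  have pint: "integrable (lborel \<Otimes>\<^sub>M lborel) (\<lambda>(x, y). e (Re w) x * e (- Im w) y)"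
  proof (rule lborel_pair.Fubini_integrable)
    show "integrable lborel (\<lambda>x. \<integral>y. norm (case (x, y) of (x, y) \<Rightarrow> e (Re w) x * e (- Im w) y) \<partial>lborel)"
      using integrable_norm[OF int] by (simp add: norm_mult)
    show "AE x in lborel. integrable lborel (\<lambda>y. case (x, y) of (x, y) \<Rightarrow> e (Re w) x * e (- Im w) y)"
      using int by simp
  qed measurable
  have "integrable lborel F"
    by (subst lborel_complex_eq_distr, subst integrable_distr_eq)
      (use pint in \<open>simp_all add: eq case_prod_unfold\<close>)
  then show "integrable lborel (\<lambda>z. of_real (exp (- (cmod z)\<^sup>2)) * exp (2 * \<i> * of_real (Re (z * w))))"
    unfolding F_def .
  have "integral\<^sup>L lborel F = (\<integral>(x, y). e (Re w) x * e (- Im w) y \<partial>(lborel \<Otimes>\<^sub>M lborel))"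
    by (subst lborel_complex_eq_distr, subst integral_distr) (simp_all add: eq case_prod_unfold)
  also have "\<dots> = (\<integral>x. \<integral>y. e (Re w) x * e (- Im w) y \<partial>lborel \<partial>lborel)"
    using lborel_pair.integral_fst[OF pint] by simp
  also have "\<dots> = of_real (sqrt pi * exp (- (Re w)\<^sup>2)) * of_real (sqrt pi * exp (- (Im w)\<^sup>2))"
    by (simp add: inte)
  also have "\<dots> = of_real (pi * exp (- (cmod w)\<^sup>2))"
    by (simp add: cmod_power2 exp_add[symmetric] exp_diff exp_minus field_simps flip: of_real_mult)
  finally show "(\<integral>z. of_real (exp (- (cmod z)\<^sup>2)) * exp (2 * \<i> * of_real (Re (z * w))) \<partial>lborel)
      = of_real (pi * exp (- (cmod w)\<^sup>2))"
    unfolding F_def .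
qed

section \<open>The double Gaussian integral for a fixed matrix\<close>

lemma norm_vec_square: "(norm (x :: 'a::real_normed_vector^'n))\<^sup>2 = (\<Sum>i\<in>UNIV. (norm (x $ i))\<^sup>2)"
  by (simp add: norm_vec_def L2_set_def sum_nonneg)

definition gauss_weight :: "complex^'n^'r \<Rightarrow> real" where
  "gauss_weight s = exp (- (\<Sum>l\<in>UNIV. (norm (s $ l))\<^sup>2))"

lemma measurable_gauss_weight [measurable]: "gauss_weight \<in> borel_measurable borel"
  unfolding gauss_weight_def by measurable

lemma integrable_gauss_weight: "integrable lborel (gauss_weight :: complex^'n^'r \<Rightarrow> real)"
proof -
  have 1: "integrable (lborel :: complex measure) (\<lambda>z. exp (- (cmod z)\<^sup>2))"
    using integrable_complex_gaussian_character[of 0] by (simp add: complex_of_real_integrable_eq)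
  have "integrable lborel (\<lambda>v :: complex^'n. exp (- (norm v)\<^sup>2))"
    using integrable_lborel_vec_prod[of "\<lambda>_::'n. \<lambda>z::complex. exp (- (cmod z)\<^sup>2)", OF 1]
    by (simp add: norm_vec_square sum_negf[symmetric] exp_sum)
  from integrable_lborel_vec_prod[of "\<lambda>_::'r. \<lambda>v :: complex^'n. exp (- (norm v)\<^sup>2)", OF this]
  show ?thesis by (simp add: gauss_weight_def[abs_def] sum_negf[symmetric] exp_sum)
qed

text \<open>The exponent is grouped by the entries of \<open>A\<close>, the form that suits
  independence: the coefficient of \<open>A $ j $ k\<close> is the number whose squared modulus
  becomes the argument of \<open>G\<close>.\<close>

definition gauss_phase :: "('r::finite \<Rightarrow> real) \<Rightarrow> complex^'n^'m \<Rightarrow> complex^'n^'r \<Rightarrow> complex^'m^'r \<Rightarrow> complex" where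
  "gauss_phase t A s p = exp (2 * \<i> * of_real (Re (\<Sum>j\<in>UNIV. \<Sum>k\<in>UNIV.
      A $ j $ k * (\<Sum>l\<in>UNIV. of_real (t l) * s $ l $ k * p $ l $ j))))"

lemma norm_gauss_phase: "norm (gauss_phase t A s p) = 1"
  by (simp add: gauss_phase_def)

text \<open>The same bilinear exponent regrouped by the entries of \<open>p\<close>, the form that
  suits the Gaussian integral over \<open>p\<close>: each entry is coupled to one number
  only.\<close>

lemma gauss_phase_eq:
  "gauss_phase t A s p = (\<Prod>l\<in>UNIV. \<Prod>j\<in>UNIV.
     exp (2 * \<i> * of_real (Re (p $ l $ j * (of_real (t l) * (A *v s $ l) $ j)))))"
proof -
  have "(\<Sum>j\<in>UNIV. \<Sum>k\<in>UNIV. A $ j $ k * (\<Sum>l\<in>UNIV. of_real (t l) * s $ l $ k * p $ l $ j))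
     = (\<Sum>j\<in>UNIV. \<Sum>k\<in>UNIV. \<Sum>l\<in>UNIV. A $ j $ k * (of_real (t l) * s $ l $ k * p $ l $ j))"
    by (simp add: sum_distrib_left)
  also have "\<dots> = (\<Sum>j\<in>UNIV. \<Sum>l\<in>UNIV. \<Sum>k\<in>UNIV. A $ j $ k * (of_real (t l) * s $ l $ k * p $ l $ j))"
    by (intro sum.cong refl sum.swap)
  also have "\<dots> = (\<Sum>l\<in>UNIV. \<Sum>j\<in>UNIV. \<Sum>k\<in>UNIV. A $ j $ k * (of_real (t l) * s $ l $ k * p $ l $ j))"
    by (rule sum.swap)
  also have "\<dots> = (\<Sum>l\<in>UNIV. \<Sum>j\<in>UNIV. p $ l $ j * (of_real (t l) * (A *v s $ l) $ j))"
    by (simp add: matrix_vector_mult_def sum_distrib_left mult_ac)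
  finally show ?thesis
    unfolding gauss_phase_def by (simp only: Re_sum of_real_sum sum_distrib_left exp_sum finite)
qed

lemma integral_gauss_phase_inner:
  fixes A :: "complex^'n^'m" and s :: "complex^'n^'r"
  shows "(\<integral>p. of_real (gauss_weight p) * gauss_phase t A s p \<partial>lborel)
    = of_real (pi ^ (CARD('r) * CARD('m)) * (\<Prod>l\<in>UNIV. exp (- ((t l)\<^sup>2 * (norm (A *v s $ l))\<^sup>2))))"
proof -
  define F where "F l j z = complex_of_real (exp (- (cmod z)\<^sup>2)) *
    exp (2 * \<i> * of_real (Re (z * (of_real (t l) * (A *v s $ l) $ j))))" for l j z
  have intF: "integrable lborel (F l j)" for l j
    unfolding F_def by (rule integrable_complex_gaussian_character)
  have integF: "integral\<^sup>L lborel (F l j) = of_real (pi * exp (- ((t l)\<^sup>2 * (cmod ((A *v s $ l) $ j))\<^sup>2)))" for l j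
    unfolding F_def integral_complex_gaussian_character by (simp add: norm_mult power_mult_distrib)
  have int': "integrable lborel (\<lambda>v. \<Prod>j\<in>UNIV. F l j (v $ j))" for l
    by (rule integrable_lborel_vec_prod[OF intF])
  have "of_real (gauss_weight p) * gauss_phase t A s p = (\<Prod>l\<in>UNIV. \<Prod>j\<in>UNIV. F l j (p $ l $ j))" for p
    by (simp add: F_def gauss_phase_eq prod.distrib gauss_weight_def norm_vec_square sum_negf[symmetric] exp_sum)
  then have "(\<integral>p. of_real (gauss_weight p) * gauss_phase t A s p \<partial>lborel)
      = (\<Prod>l\<in>UNIV. \<Prod>j\<in>UNIV. integral\<^sup>L lborel (F l j))"
    \<comment> \<open>The first product formula runs over the vectors \<open>p $ l\<close>, the
      second over their entries. The instance \<open>\<lambda>l. l\<close> ties the free index in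
      \<open>int'\<close> to the index of the outer product.\<close>
    by (simp add: integral_lborel_vec_prod[OF int', of "\<lambda>l. l"] integral_lborel_vec_prod[OF intF])
  also have "\<dots> = (\<Prod>l\<in>UNIV. of_real (pi ^ CARD('m) * exp (- ((t l)\<^sup>2 * (norm (A *v s $ l))\<^sup>2))))"
    by (intro prod.cong refl)
      (simp add: integF prod.distrib norm_vec_square sum_distrib_left sum_negf[symmetric] exp_sum)
  finally show ?thesis by (simp add: prod.distrib power_mult mult.commute)
qed

lemma measurable_gauss_phase [measurable (raw)]:
  assumes [measurable]: "A \<in> borel_measurable M" "s \<in> borel_measurable M" "p \<in> borel_measurable M"
  shows "(\<lambda>x. gauss_phase t (A x) (s x) (p x)) \<in> borel_measurable M"
  unfolding gauss_phase_def by measurable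

text \<open>The majorant for each application of Fubini to an integrand containing
  \<open>gauss_phase\<close>.\<close>

lemma integrable_gauss_weight_pair:
  "integrable lborel (\<lambda>(s :: complex^'n^'r, p :: complex^'m^'r). gauss_weight s * gauss_weight p)"
  unfolding lborel_prod[symmetric]
  by (intro integrable_pair_mult sigma_finite_lborel integrable_gauss_weight)

lemma integral_gauss_phase:
  fixes A :: "complex^'n^'m" and t :: "'r::finite \<Rightarrow> real"
  shows "(\<integral>(s, p). of_real (gauss_weight s * gauss_weight p) * gauss_phase t A s p
        \<partial>(lborel :: ((complex^'n^'r) \<times> (complex^'m^'r)) measure))
    = of_real (pi ^ (CARD('r) * (CARD('n) + CARD('m)))) *
      inverse (\<Prod>l\<in>UNIV. det (mat 1 + (t l)\<^sup>2 *\<^sub>R (conj_transpose A ** A)))"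
proof -
  have int: "integrable (lborel \<Otimes>\<^sub>M lborel) (\<lambda>(s :: complex^'n^'r, p :: complex^'m^'r).
      of_real (gauss_weight s * gauss_weight p) * gauss_phase t A s p)"
    by (rule Bochner_Integration.integrable_bound[OF integrable_gauss_weight_pair[unfolded lborel_prod[symmetric]]])
      (auto simp: norm_mult norm_gauss_phase case_prod_unfold)
  let ?D = "\<lambda>l d. 0 < d \<and> det (mat 1 + (t l)\<^sup>2 *\<^sub>R (conj_transpose A ** A)) = of_real d \<and>
    (\<integral>\<^sup>+s. ennreal (exp (- ((norm s)\<^sup>2 + (t l)\<^sup>2 * (norm (A *v s))\<^sup>2))) \<partial>lborel) = ennreal (pi ^ CARD('n) / d)"
  have "\<exists>d. ?D l d" for l
    by (rule nn_integral_gaussian_one_plus_gram[of "t l" A]) blast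
  then have "\<exists>d. \<forall>l. ?D l (d l)"
    by (intro choice allI)
  then obtain d where d: "\<And>l. 0 < d l" "\<And>l. det (mat 1 + (t l)\<^sup>2 *\<^sub>R (conj_transpose A ** A)) = of_real (d l)"
    "\<And>l. (\<integral>\<^sup>+s. ennreal (exp (- ((norm s)\<^sup>2 + (t l)\<^sup>2 * (norm (A *v s))\<^sup>2))) \<partial>lborel) = ennreal (pi ^ CARD('n) / d l)"
    by blast
  \<comment> \<open>The Gaussian weight in row \<open>l\<close> of \<open>s\<close> times the factor
    left behind by the integration over \<open>p\<close>.\<close>
  define E where "E l s = exp (- ((norm s)\<^sup>2 + (t l)\<^sup>2 * (norm (A *v s))\<^sup>2))" for l and s :: "complex^'n"
  have [measurable]: "E l \<in> borel_measurable borel" for l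
    unfolding E_def by (intro borel_measurable_continuous_onI continuous_intros matrix_vector_mult_linear_continuous_on)
  \<comment> \<open>As \<open>E l\<close> is nonnegative, a finite nonnegative integral yields
    integrability and the value together.\<close>
  have E: "has_bochner_integral lborel (E l) (pi ^ CARD('n) / d l)" for l
    by (rule has_bochner_integral_nn_integral) (use d in \<open>auto simp: E_def intro: less_imp_le\<close>)
  have "(\<integral>(s, p). of_real (gauss_weight s * gauss_weight p) * gauss_phase t A s p
        \<partial>(lborel :: ((complex^'n^'r) \<times> (complex^'m^'r)) measure))
      = (\<integral>s. \<integral>p. of_real (gauss_weight s * gauss_weight p) * gauss_phase t A s p \<partial>lborel \<partial>lborel)"
    using lborel_pair.integral_fst[OF int] by (simp add: lborel_prod)
  also have "\<dots> = (\<integral>s. of_real (pi ^ (CARD('r) * CARD('m)) * (\<Prod>l\<in>UNIV. E l (s $ l))) \<partial>lborel)"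
  proof (rule Bochner_Integration.integral_cong[OF refl])
    fix s :: "complex^'n^'r"
    have gw: "gauss_weight s = (\<Prod>l\<in>UNIV. exp (- (norm (s $ l))\<^sup>2))"
      by (simp add: gauss_weight_def sum_negf[symmetric] exp_sum)
    have E_eq: "E l (s $ l) = exp (- (norm (s $ l))\<^sup>2) * exp (- ((t l)\<^sup>2 * (norm (A *v s $ l))\<^sup>2))" for l
      by (simp add: E_def exp_add[symmetric])
    have "(\<integral>p. of_real (gauss_weight s * gauss_weight p) * gauss_phase t A s p \<partial>lborel)
        = of_real (gauss_weight s) * (\<integral>p. of_real (gauss_weight p) * gauss_phase t A s p \<partial>lborel)"
      by (simp only: of_real_mult mult.assoc integral_mult_right_zero)
    also have "\<dots> = of_real (pi ^ (CARD('r) * CARD('m)) * (\<Prod>l\<in>UNIV. E l (s $ l)))"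
      unfolding integral_gauss_phase_inner gw E_eq prod.distrib of_real_mult by (simp only: mult_ac)
    finally show "(\<integral>p. of_real (gauss_weight s * gauss_weight p) * gauss_phase t A s p \<partial>lborel)
        = of_real (pi ^ (CARD('r) * CARD('m)) * (\<Prod>l\<in>UNIV. E l (s $ l)))" .
  qed
  also have "\<dots> = of_real (pi ^ (CARD('r) * CARD('m)) * (\<Prod>l\<in>UNIV. pi ^ CARD('n) / d l))"
    using E by (subst integral_complex_of_real)
      (simp add: integral_lborel_vec_prod has_bochner_integral_iff)
  also have "\<dots> = of_real (pi ^ (CARD('r) * (CARD('n) + CARD('m)))) *
      inverse (\<Prod>l\<in>UNIV. det (mat 1 + (t l)\<^sup>2 *\<^sub>R (conj_transpose A ** A)))"
  proof -
    have 1: "(\<Prod>l\<in>UNIV. pi ^ CARD('n) / d l) = pi ^ (CARD('n) * CARD('r)) / (\<Prod>l\<in>UNIV. d l)"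
      by (simp add: prod_dividef power_mult)
    have 2: "pi ^ (CARD('r) * (CARD('n) + CARD('m))) = pi ^ (CARD('r) * CARD('m)) * pi ^ (CARD('n) * CARD('r))"
      by (simp add: power_add[symmetric] algebra_simps)
    show ?thesis
      unfolding d 1 2 of_real_prod[symmetric] of_real_inverse[symmetric] of_real_mult[symmetric]
      by (simp add: divide_inverse mult.assoc)
  qed
  finally show ?thesis .
qed

subsection \<open>The Bessel kernel\<close>

lemma phi_summable: "summable (\<lambda>l. (-1)^l / (fact l)^2 * (x::real)^l)"
proof (rule summable_comparison_test'[where N=0])
  show "summable (\<lambda>l. \<bar>x\<bar>^l / fact l)"
    using summable_exp[of "\<bar>x\<bar>"] by (simp add: field_simps)
  fix l :: nat
  have "(1::real) \<le> fact l" by simp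
  then have "\<bar>x\<bar>^l * 1 \<le> \<bar>x\<bar>^l * fact l" by (intro mult_left_mono) auto
  then show "norm ((-1)^l / (fact l)^2 * x^l) \<le> \<bar>x\<bar>^l / fact l"
    by (simp add: abs_mult power_abs field_simps power2_eq_square)
qed

lemma phi_eq_bessel_J0: "0 \<le> x \<Longrightarrow> phi x = bessel_J0 (2 * sqrt x)"
  by (simp add: phi_def bessel_J0_def power_mult)

text \<open>The derivative of \<open>sin * cos ^ (k + 1)\<close> integrates to zero over a full
  period, which is the recursion \<open>rec\<close> from \<open>k\<close> to \<open>k + 2\<close>;
  \<open>c0\<close> and \<open>c1\<close> start its two branches. The shift \<open>a\<close> is kept
  because the angle later arrives as \<open>\<theta> + Arg (a * z)\<close>.\<close>

lemma cos_power_integral: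
  fixes a :: real
  defines "c \<equiv> \<lambda>k. LBINT \<theta>:{0..2*pi}. cos (\<theta> + a) ^ k"
  shows "c (2 * l) = 2 * pi * fact (2 * l) / (4 ^ l * (fact l)^2)" "c (Suc (2 * l)) = 0"
proof -
  have int: "set_integrable lborel {0..2*pi} (\<lambda>\<theta>. cos (\<theta> + a) ^ k)" for k
    by (intro borel_integrable_atLeastAtMost' continuous_intros)
  have per: "cos (2 * pi + a) = cos a" "sin (2 * pi + a) = sin a"
    by (simp_all add: cos_add sin_add)
  have c0: "c 0 = 2 * pi"
    by (simp add: c_def set_lebesgue_integral_def)
  have "c 1 = sin (2 * pi + a) - sin (0 + a)"
    unfolding c_def set_lebesgue_integral_def real_scaleR_def power_one_right
    by (subst mult.commute, rule integral_FTC_Icc_real) (auto intro!: derivative_eq_intros continuous_intros)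
  then have c1: "c 1 = 0" by (simp add: per)
  have rec: "real (k + 2) * c (k + 2) = real (k + 1) * c k" for k
  proof -
    have "(\<integral>\<theta>. (real (k + 2) * cos (\<theta> + a) ^ (k + 2) - real (k + 1) * cos (\<theta> + a) ^ k)
            * indicator {0..2*pi} \<theta> \<partial>lborel)
        = sin (2 * pi + a) * cos (2 * pi + a) ^ (k + 1) - sin (0 + a) * cos (0 + a) ^ (k + 1)"
    proof (rule integral_FTC_Icc_real)
      fix \<theta>
      have sq: "(sin (\<theta> + a))\<^sup>2 = 1 - (cos (\<theta> + a))\<^sup>2" by (simp add: sin_squared_eq)
      have ds: "DERIV (\<lambda>\<theta>. sin (\<theta> + a)) \<theta> :> cos (\<theta> + a)"
        and dc: "DERIV (\<lambda>\<theta>. cos (\<theta> + a)) \<theta> :> - sin (\<theta> + a)"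
        by (auto intro!: derivative_eq_intros)
      have "DERIV (\<lambda>\<theta>. sin (\<theta> + a) * cos (\<theta> + a) ^ (k + 1)) \<theta> :>
        cos (\<theta> + a) * cos (\<theta> + a) ^ (k + 1) - real (k + 1) * cos (\<theta> + a) ^ k * (sin (\<theta> + a))\<^sup>2"
        by (rule DERIV_cong[OF DERIV_mult[OF ds DERIV_power[OF dc]]]) (simp add: power2_eq_square)
      also have "cos (\<theta> + a) * cos (\<theta> + a) ^ (k + 1) - real (k + 1) * cos (\<theta> + a) ^ k * (sin (\<theta> + a))\<^sup>2
        = real (k + 2) * cos (\<theta> + a) ^ (k + 2) - real (k + 1) * cos (\<theta> + a) ^ k"
        unfolding sq by (simp add: algebra_simps power2_eq_square)
      finally show "DERIV (\<lambda>\<theta>. sin (\<theta> + a) * cos (\<theta> + a) ^ (k + 1)) \<theta> :>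
        real (k + 2) * cos (\<theta> + a) ^ (k + 2) - real (k + 1) * cos (\<theta> + a) ^ k" .
    qed (auto intro!: continuous_intros)
    also have "\<dots> = 0" by (simp add: per)
    also have "(\<integral>\<theta>. (real (k + 2) * cos (\<theta> + a) ^ (k + 2) - real (k + 1) * cos (\<theta> + a) ^ k)
            * indicator {0..2*pi} \<theta> \<partial>lborel)
        = (LBINT \<theta>:{0..2*pi}. real (k + 2) * cos (\<theta> + a) ^ (k + 2) - real (k + 1) * cos (\<theta> + a) ^ k)"
      by (simp add: set_lebesgue_integral_def mult.commute)
    also have "\<dots> = real (k + 2) * c (k + 2) - real (k + 1) * c k"
      unfolding c_def by (subst set_integral_diff) (use int in \<open>auto simp del: power_Suc\<close>)
    finally show ?thesis by simp
  qed
  show "c (2 * l) = 2 * pi * fact (2 * l) / (4 ^ l * (fact l)^2)"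
  proof (induction l)
    case 0
    then show ?case by (simp add: c0)
  next
    case (Suc l)
    have "c (2 * Suc l) = real (2 * l + 1) / real (2 * l + 2) * c (2 * l)"
      using rec[of "2 * l"] by (simp add: field_simps)
    also have "\<dots> = 2 * pi * fact (2 * Suc l) / (4 ^ Suc l * (fact (Suc l))^2)"
      unfolding Suc.IH by (simp add: divide_simps power2_eq_square) (simp add: algebra_simps)
    finally show ?case .
  qed
  show "c (Suc (2 * l)) = 0"
  proof (induction l)
    case 0
    then show ?case using c1 by simp
  next
    case (Suc l)
    then show ?case using rec[of "Suc (2 * l)"] by simp
  qed
qed

text \<open>Integrate the exponential series term by term. Odd powers of the cosine vanish; in the
  term of order \<open>2 * l\<close> the factors \<open>fact (2 * l)\<close> and
  \<open>4 ^ l\<close> cancel, leaving the coefficient of \<open>phi\<close> times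
  \<open>2 * pi\<close>.\<close>

lemma integral_exp_cos_eq_phi:
  fixes w a :: real
  shows "(LBINT \<theta>:{0..2*pi}. exp (2 * \<i> * of_real (w * cos (\<theta> + a)))) = of_real (2 * pi * phi (w\<^sup>2))"
proof -
  define F where "F k \<theta> = indicator {0..2*pi} \<theta> *\<^sub>R ((2 * \<i> * of_real (w * cos (\<theta> + a))) ^ k /\<^sub>R fact k)" for k \<theta>
  have int: "set_integrable lborel {0..2*pi} (\<lambda>\<theta>. cos (\<theta> + a) ^ k)" for k
    by (intro borel_integrable_atLeastAtMost' continuous_intros)
  have F_eq: "F k \<theta> = of_real (indicator {0..2*pi} \<theta> *\<^sub>R cos (\<theta> + a) ^ k) * ((2 * \<i> * of_real w) ^ k / fact k)" for k \<theta>
    by (simp add: F_def power_mult_distrib field_simps scaleR_conv_of_real)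
  have intF: "integrable lborel (F k)" for k
    unfolding F_eq using int[of k] unfolding set_integrable_def
    by (intro integrable_mult_left integrable_of_real)
  have integralF: "integral\<^sup>L lborel (F k) = of_real (LBINT \<theta>:{0..2*pi}. cos (\<theta> + a) ^ k) * ((2 * \<i> * of_real w) ^ k / fact k)" for k
    unfolding F_eq set_lebesgue_integral_def by (subst integral_mult_left_zero, subst integral_complex_of_real) (rule refl)
  have normF: "norm (F k \<theta>) \<le> indicator {0..2*pi} \<theta> * ((2 * \<bar>w\<bar>) ^ k / fact k)" for k \<theta>
  proof -
    have "\<bar>cos (\<theta> + a)\<bar> ^ k \<le> 1" by (intro power_le_one) auto
    then have "\<bar>cos (\<theta> + a)\<bar> ^ k * ((2 * \<bar>w\<bar>) ^ k / fact k) \<le> 1 * ((2 * \<bar>w\<bar>) ^ k / fact k)"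
      by (intro mult_right_mono) auto
    then show ?thesis
      unfolding F_eq by (auto simp: norm_mult norm_divide norm_power power_abs indicator_def power_mult_distrib)
  qed
  have sumexp: "summable (\<lambda>k. (2 * \<bar>w\<bar>) ^ k / fact k)"
    using summable_exp[of "2 * \<bar>w\<bar>"] by (simp add: field_simps)
  have "(\<lambda>k. integral\<^sup>L lborel (F k)) sums (\<integral>\<theta>. (\<Sum>k. F k \<theta>) \<partial>lborel)"
  proof (rule sums_integral[OF intF])
    show "AE \<theta> in lborel. summable (\<lambda>k. norm (F k \<theta>))"
    proof (rule AE_I2, rule summable_comparison_test'[where N=0])
      fix \<theta> show "summable (\<lambda>k. indicator {0..2*pi} \<theta> * ((2 * \<bar>w\<bar>) ^ k / fact k))"
        by (intro summable_mult sumexp)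
      show "norm (norm (F k \<theta>)) \<le> indicator {0..2*pi} \<theta> * ((2 * \<bar>w\<bar>) ^ k / fact k)" for k
        using normF by simp
    qed
    have b: "(\<integral>\<theta>. norm (F k \<theta>) \<partial>lborel) \<le> 2 * pi * ((2 * \<bar>w\<bar>) ^ k / fact k)" for k
    proof -
      have "(\<integral>\<theta>. norm (F k \<theta>) \<partial>lborel) \<le> (\<integral>\<theta>. indicator {0..2*pi} \<theta> * ((2 * \<bar>w\<bar>) ^ k / fact k) \<partial>lborel)"
        by (intro integral_mono normF integrable_norm intF) (auto intro!: integrable_mult_left)
      then show ?thesis by simp
    qed
    show "summable (\<lambda>k. \<integral>\<theta>. norm (F k \<theta>) \<partial>lborel)"
      by (rule summable_comparison_test'[where N=0, OF summable_mult[OF sumexp, of "2 * pi"]])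
        (use b in auto)
  qed
  also have "(\<integral>\<theta>. (\<Sum>k. F k \<theta>) \<partial>lborel) = (LBINT \<theta>:{0..2*pi}. exp (2 * \<i> * of_real (w * cos (\<theta> + a))))"
    unfolding set_lebesgue_integral_def F_def
    by (intro Bochner_Integration.integral_cong refl)
      (subst suminf_scaleR_right[symmetric], use summable_exp_generic in \<open>auto simp: exp_def\<close>)
  finally have sums: "(\<lambda>k. integral\<^sup>L lborel (F k)) sums (LBINT \<theta>:{0..2*pi}. exp (2 * \<i> * of_real (w * cos (\<theta> + a))))" .
  have odd: "integral\<^sup>L lborel (F k) = 0" if "odd k" for k
    using that cos_power_integral(2)[of a] by (auto simp: integralF elim!: oddE)
  have even: "integral\<^sup>L lborel (F (2 * l)) = of_real (2 * pi * ((-1)^l / (fact l)^2 * (w\<^sup>2)^l))" for l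
  proof -
    have "(2 * \<i> * of_real w)\<^sup>2 = (-1) * 4 * complex_of_real (w\<^sup>2)"
      by (simp add: power_mult_distrib)
    then have "(2 * \<i> * of_real w) ^ (2 * l) = (-1) ^ l * 4 ^ l * complex_of_real (w\<^sup>2) ^ l"
      by (simp only: power_mult power_mult_distrib)
    then show ?thesis
      unfolding integralF cos_power_integral(1) by simp
  qed
  \<comment> \<open>Deleting the vanishing odd terms does not change the sum.\<close>
  have "(\<lambda>l. integral\<^sup>L lborel (F (2 * l))) sums (LBINT \<theta>:{0..2*pi}. exp (2 * \<i> * of_real (w * cos (\<theta> + a))))"
    using sums odd by (subst sums_mono_reindex[of "\<lambda>l. 2 * l"]) (auto simp: strict_mono_def elim!: evenE)
  moreover have "(\<lambda>l. integral\<^sup>L lborel (F (2 * l))) sums (of_real (2 * pi * phi (w\<^sup>2)))"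
    unfolding even phi_def by (intro sums_of_real sums_mult summable_sums phi_summable)
  ultimately show ?thesis by (rule sums_unique2)
qed

lemma measurable_phi [measurable]: "phi \<in> borel_measurable borel"
  unfolding phi_def by measurable

section \<open>Characters of radial laws in the plane\<close>

lemma integral_cmod_square:
  fixes g :: "real \<Rightarrow> 'b::{banach, second_countable_topology}"
  assumes [measurable]: "g \<in> borel_measurable borel"
  shows "(\<integral>z. g ((cmod z)\<^sup>2) \<partial>lborel) = pi *\<^sub>R (LBINT x:{0<..}. g x)"
proof -
  have "(\<integral>z. g ((cmod z)\<^sup>2) \<partial>lborel) = (\<integral>x. g x \<partial>distr (lborel :: complex measure) borel (\<lambda>z. (cmod z)\<^sup>2))"
    by (subst integral_distr) auto
  also have "\<dots> = (\<integral>x. (pi * indicator {0<..} x) *\<^sub>R g x \<partial>lborel)"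
    unfolding distr_lborel_cmod_square by (subst integral_density) auto
  also have "\<dots> = pi *\<^sub>R (LBINT x:{0<..}. g x)"
    by (simp add: set_lebesgue_integral_def flip: scaleR_scaleR)
  finally show ?thesis .
qed

lemma integrable_cmod_square:
  fixes g :: "real \<Rightarrow> 'b::{banach, second_countable_topology}"
  assumes [measurable]: "g \<in> borel_measurable borel" and g: "set_integrable lborel {0<..} g"
  shows "integrable (lborel :: complex measure) (\<lambda>z. g ((cmod z)\<^sup>2))"
proof -
  have "integrable (distr (lborel :: complex measure) borel (\<lambda>z. (cmod z)\<^sup>2)) g"
    unfolding distr_lborel_cmod_square
    using g by (subst integrable_density) (auto simp: set_integrable_def simp flip: scaleR_scaleR)
  then show ?thesis by (subst (asm) integrable_distr_eq) auto
qed

text \<open>Averaging over all rotations replaces the character by its angular mean \<^const>\<open>phi\<close>.\<close>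
lemma integral_radial_character:
  fixes g :: "real \<Rightarrow> real" and z :: complex
  assumes [measurable]: "g \<in> borel_measurable borel" and g: "set_integrable lborel {0<..} g"
  shows "(\<integral>a. g ((cmod a)\<^sup>2) *\<^sub>R exp (2 * \<i> * of_real (Re (a * z))) \<partial>lborel)
    = of_real (pi * (LBINT x:{0<..}. g x * phi (x * (cmod z)\<^sup>2)))"
proof -
  define h where "h a = g ((cmod a)\<^sup>2) *\<^sub>R exp (2 * \<i> * of_real (Re (a * z)))" for a
  have [measurable]: "h \<in> borel_measurable borel"
    unfolding h_def by measurable
  have rot: "(\<integral>a. h (cis \<theta> * a) \<partial>lborel) = integral\<^sup>L lborel h" for \<theta>
  proof -
    have "integral\<^sup>L (distr lborel borel (\<lambda>a. cis \<theta> * a)) h = (\<integral>a. h (cis \<theta> * a) \<partial>lborel)"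
      by (rule integral_distr) measurable
    then show ?thesis by (simp add: distr_lborel_rotate)
  qed
  \<comment> \<open>In polar form the rotation keeps \<open>cmod a\<close> and adds
    \<open>\<theta>\<close> to the argument of \<open>a * z\<close>, so the integral over
    \<open>\<theta>\<close> becomes the shifted cosine integral.\<close>
  have cisH: "h (cis \<theta> * a) = g ((cmod a)\<^sup>2) *\<^sub>R exp (2 * \<i> * of_real (cmod (a * z) * cos (\<theta> + Arg (a * z))))" for \<theta> a
  proof -
    have "cis \<theta> * a * z = cis \<theta> * (cmod (a * z) * cis (Arg (a * z)))"
      by (metis mult.assoc rcis_cmod_Arg rcis_def)
    also have "\<dots> = of_real (cmod (a * z)) * cis (\<theta> + Arg (a * z))"
      by (metis mult.left_commute cis_mult)
    finally have "Re (cis \<theta> * a * z) = cmod (a * z) * cos (\<theta> + Arg (a * z))"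
      by (simp only:) simp
    then show ?thesis by (simp add: h_def norm_mult)
  qed
  have [measurable]: "(\<lambda>\<theta>. cis \<theta>) \<in> borel_measurable borel"
    by (intro borel_measurable_continuous_onI continuous_intros)
  have int: "integrable (lborel \<Otimes>\<^sub>M lborel) (\<lambda>(\<theta>, a). indicator {0..2*pi} \<theta> *\<^sub>R h (cis \<theta> * a))"
  proof (rule Bochner_Integration.integrable_bound)
    show "integrable (lborel \<Otimes>\<^sub>M lborel) (\<lambda>(\<theta>::real, a::complex). indicator {0..2*pi} \<theta> * g ((cmod a)\<^sup>2))"
      by (intro integrable_pair_mult sigma_finite_lborel integrable_cmod_square g) auto
    show "(\<lambda>(\<theta>, a). indicator {0..2*pi} \<theta> *\<^sub>R h (cis \<theta> * a)) \<in> borel_measurable (lborel \<Otimes>\<^sub>M lborel)"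
      by measurable
  qed (auto simp: cisH)
  \<comment> \<open>By \<open>rot\<close> the integral of the rotated function is independent of
    \<open>\<theta>\<close>, so integrating it over a full turn merely multiplies by
    \<open>2 * pi\<close>.\<close>
  have "of_real (2 * pi) * integral\<^sup>L lborel h = (LBINT \<theta>:{0..2*pi}. integral\<^sup>L lborel h)"
    by (simp add: set_lebesgue_integral_def scaleR_conv_of_real)
  also have "\<dots> = (\<integral>\<theta>. \<integral>a. indicator {0..2*pi} \<theta> *\<^sub>R h (cis \<theta> * a) \<partial>lborel \<partial>lborel)"
    by (simp add: set_lebesgue_integral_def rot)
  also have "\<dots> = (\<integral>a. \<integral>\<theta>. indicator {0..2*pi} \<theta> *\<^sub>R h (cis \<theta> * a) \<partial>lborel \<partial>lborel)"
    by (rule lborel_pair.Fubini_integral[symmetric]) (use int in simp)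
  also have "\<dots> = (\<integral>a. of_real (g ((cmod a)\<^sup>2) * (2 * pi * phi ((cmod a)\<^sup>2 * (cmod z)\<^sup>2))) \<partial>lborel)"
  proof (rule Bochner_Integration.integral_cong[OF refl])
    fix a
    have "(\<integral>\<theta>. indicator {0..2*pi} \<theta> *\<^sub>R h (cis \<theta> * a) \<partial>lborel)
      = (\<integral>\<theta>. g ((cmod a)\<^sup>2) *\<^sub>R (indicator {0..2*pi} \<theta> *\<^sub>R
          exp (2 * \<i> * of_real (cmod (a * z) * cos (\<theta> + Arg (a * z))))) \<partial>lborel)"
      unfolding cisH by (simp only: scaleR_left_commute)
    also have "\<dots> = g ((cmod a)\<^sup>2) *\<^sub>R of_real (2 * pi * phi ((cmod (a * z))\<^sup>2))"
      by (simp only: integral_scaleR_right integral_exp_cos_eq_phi[unfolded set_lebesgue_integral_def])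
    finally show "(\<integral>\<theta>. indicator {0..2*pi} \<theta> *\<^sub>R h (cis \<theta> * a) \<partial>lborel)
      = of_real (g ((cmod a)\<^sup>2) * (2 * pi * phi ((cmod a)\<^sup>2 * (cmod z)\<^sup>2)))"
      by (simp add: norm_mult power_mult_distrib scaleR_conv_of_real)
  qed
  also have "\<dots> = of_real (\<integral>a. g ((cmod a)\<^sup>2) * (2 * pi * phi ((cmod a)\<^sup>2 * (cmod z)\<^sup>2)) \<partial>lborel)"
    by (rule integral_complex_of_real)
  also have "(\<integral>a. g ((cmod a)\<^sup>2) * (2 * pi * phi ((cmod a)\<^sup>2 * (cmod z)\<^sup>2)) \<partial>lborel)
      = pi * (LBINT x:{0<..}. g x * (2 * pi * phi (x * (cmod z)\<^sup>2)))"
    using integral_cmod_square[of "\<lambda>x. g x * (2 * pi * phi (x * (cmod z)\<^sup>2))"] by simp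
  also have "(LBINT x:{0<..}. g x * (2 * pi * phi (x * (cmod z)\<^sup>2)))
      = 2 * pi * (LBINT x:{0<..}. g x * phi (x * (cmod z)\<^sup>2))"
    by (subst set_integral_mult_right[symmetric]) (simp add: mult_ac)
  finally have "of_real (2 * pi) * integral\<^sup>L lborel h
      = of_real (2 * pi) * complex_of_real (pi * (LBINT x:{0<..}. g x * phi (x * (cmod z)\<^sup>2)))"
    by (simp add: mult_ac)
  then show ?thesis
    unfolding h_def[abs_def] using pi_gt_zero by (simp only: mult_cancel_left) simp
qed

text \<open>After Fubini the angular integral is the inner one, and its value
  \<open>2 * pi * phi (x * y)\<close> cancels the prefactor of \<open>G\<close>.\<close>

lemma G_eq_integral_phi:
  assumes f: "pos_prob_density f" and y: "0 \<le> y"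
  shows "G f y = of_real (LBINT x:{0<..}. f x * phi (x * y))"
proof -
  \<comment> \<open>Integrability of \<open>f\<close> over the half-line gives no measurability
    elsewhere; the truncated \<open>g\<close> is measurable on the whole line.\<close>
  define g where "g x = indicator {0<..} x * f x" for x
  have intg: "integrable lborel g"
    using f by (simp add: pos_prob_density_def set_integrable_def g_def[abs_def])
  then have [measurable]: "g \<in> borel_measurable borel" by auto
  define e where "e \<theta> x = exp (2 * \<i> * complex_of_real (sqrt (x * y) * cos \<theta>))" for \<theta> x
  have [measurable]: "(\<lambda>(\<theta>, x). e \<theta> x) \<in> borel_measurable (borel \<Otimes>\<^sub>M borel)"
    unfolding e_def by measurable
  have int: "integrable (lborel \<Otimes>\<^sub>M lborel) (\<lambda>(x, \<theta>). indicator {0..2*pi} \<theta> *\<^sub>R (of_real (g x) * e \<theta> x))"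
  proof (rule Bochner_Integration.integrable_bound)
    show "integrable (lborel \<Otimes>\<^sub>M lborel) (\<lambda>(x, \<theta>::real). g x * indicator {0..2*pi} \<theta>)"
      by (intro integrable_pair_mult sigma_finite_lborel intg) auto
    show "(\<lambda>(x, \<theta>). indicator {0..2*pi} \<theta> *\<^sub>R (of_real (g x) * e \<theta> x)) \<in> borel_measurable (lborel \<Otimes>\<^sub>M lborel)"
      unfolding e_def by measurable
  qed (auto simp: norm_mult e_def case_prod_unfold abs_mult)
  have "(LBINT \<theta>:{0..2*pi}. (LBINT x:{0<..}. of_real (f x) * exp (2 * \<i> * of_real (sqrt (x * y) * cos \<theta>))))
      = (\<integral>\<theta>. \<integral>x. indicator {0..2*pi} \<theta> *\<^sub>R (of_real (g x) * e \<theta> x) \<partial>lborel \<partial>lborel)"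
    by (simp add: set_lebesgue_integral_def g_def e_def scaleR_conv_of_real mult.assoc)
  also have "\<dots> = (\<integral>x. \<integral>\<theta>. indicator {0..2*pi} \<theta> *\<^sub>R (of_real (g x) * e \<theta> x) \<partial>lborel \<partial>lborel)"
    by (rule lborel_pair.Fubini_integral) (use int in simp)
  also have "\<dots> = (\<integral>x. of_real (2 * pi * (g x * phi (x * y))) \<partial>lborel)"
  proof (rule Bochner_Integration.integral_cong[OF refl])
    fix x
    have "(\<integral>\<theta>. indicator {0..2*pi} \<theta> *\<^sub>R (of_real (g x) * e \<theta> x) \<partial>lborel)
        = of_real (g x) * (\<integral>\<theta>. indicator {0..2*pi} \<theta> *\<^sub>R e \<theta> x \<partial>lborel)"
      by (simp only: mult_scaleR_right[symmetric] integral_mult_right_zero)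
    also have "\<dots> = of_real (g x) * of_real (2 * pi * phi ((sqrt (x * y))\<^sup>2))"
      using integral_exp_cos_eq_phi[of "sqrt (x * y)" 0]
      by (simp add: set_lebesgue_integral_def e_def)
    \<comment> \<open>For \<open>x > 0\<close> the square undoes the root because
      \<open>x * y\<close> is nonnegative; for other \<open>x\<close> both sides vanish with
      \<open>g x\<close>.\<close>
    also have "\<dots> = of_real (2 * pi * (g x * phi (x * y)))"
      using y by (cases "x > 0") (simp_all add: g_def)
    finally show "(\<integral>\<theta>. indicator {0..2*pi} \<theta> *\<^sub>R (of_real (g x) * e \<theta> x) \<partial>lborel)
        = of_real (2 * pi * (g x * phi (x * y)))" .
  qed
  also have "\<dots> = of_real (2 * pi) * of_real (\<integral>x. g x * phi (x * y) \<partial>lborel)"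
    by (simp only: integral_complex_of_real integral_mult_right_zero) simp
  finally show ?thesis
    by (simp add: G_def set_lebesgue_integral_def g_def mult.assoc)
qed

lemma expectation_character_eq_G:
  assumes "prob_space M" and f: "pos_prob_density f"
    and X: "distributed M lborel X (\<lambda>a. ennreal (1 / pi * f ((cmod a)\<^sup>2)))"
  shows "prob_space.expectation M (\<lambda>\<omega>. exp (2 * \<i> * of_real (Re (X \<omega> * z)))) = G f ((cmod z)\<^sup>2)"
proof -
  define g where "g x = indicator {0<..} x * f x" for x
  have intg: "integrable lborel g" and g0: "0 \<le> g x" for x
    using f by (auto simp: pos_prob_density_def set_integrable_def g_def[abs_def] indicator_def)
  from intg have [measurable]: "g \<in> borel_measurable borel" by auto
  have [measurable]: "X \<in> borel_measurable M"
    using distributed_measurable[OF X] by simp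
  have [measurable]: "(\<lambda>a. ennreal (1 / pi * f ((cmod a)\<^sup>2))) \<in> borel_measurable lborel"
    using distributed_borel_measurable[OF X] .
  \<comment> \<open>The density \<open>f ((cmod a)^2)\<close> and its truncation can differ only at
    \<open>a = 0\<close>, where \<open>f 0\<close> is arbitrary.\<close>
  have "distr M lborel X = density lborel (\<lambda>a. ennreal (1 / pi * g ((cmod a)\<^sup>2)))"
    unfolding distributed_distr_eq_density[OF X]
  proof (rule density_cong)
    show "AE a in lborel. ennreal (1 / pi * f ((cmod a)\<^sup>2)) = ennreal (1 / pi * g ((cmod a)\<^sup>2))"
      using AE_lborel_singleton[of 0] by eventually_elim (simp add: g_def)
  qed measurable
  then have "prob_space.expectation M (\<lambda>\<omega>. exp (2 * \<i> * of_real (Re (X \<omega> * z))))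
      = (\<integral>a. exp (2 * \<i> * of_real (Re (a * z))) \<partial>density lborel (\<lambda>a. ennreal (1 / pi * g ((cmod a)\<^sup>2))))"
    by (subst integral_distr[symmetric, where N=lborel]) auto
  also have "\<dots> = (\<integral>a. (1 / pi * g ((cmod a)\<^sup>2)) *\<^sub>R exp (2 * \<i> * of_real (Re (a * z))) \<partial>lborel)"
    by (rule integral_density) (auto simp: g0)
  also have "\<dots> = (1 / pi) *\<^sub>R (\<integral>a. g ((cmod a)\<^sup>2) *\<^sub>R exp (2 * \<i> * of_real (Re (a * z))) \<partial>lborel)"
    by (simp only: scaleR_scaleR[symmetric] integral_scaleR_right)
  also have "\<dots> = (1 / pi) *\<^sub>R of_real (pi * (LBINT x:{0<..}. g x * phi (x * (cmod z)\<^sup>2)))"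
  proof (subst integral_radial_character)
    have "indicator {0<..} x *\<^sub>R g x = g x" for x
      by (simp add: g_def indicator_def)
    then show "set_integrable lborel {0<..} g"
      using intg by (simp only: set_integrable_def)
  qed simp_all
  also have "(LBINT x:{0<..}. g x * phi (x * (cmod z)\<^sup>2)) = (LBINT x:{0<..}. f x * phi (x * (cmod z)\<^sup>2))"
    by (rule set_lebesgue_integral_cong) (auto simp: g_def)
  finally show ?thesis
    by (simp add: G_eq_integral_phi[OF f] scaleR_conv_of_real)
qed

subsection \<open>Squared moduli of the coordinates\<close>

text \<open>Boxes determine a product of sigma-finite measures. The measure is carried to the
  function space by \<open>vec_nth\<close>, identified there, and carried back by
  \<open>vec_lambda\<close>.\<close>

lemma measure_eq_distr_PiM_vec:
  fixes M :: "('a::euclidean_space^'n) measure"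
  assumes D: "sigma_finite_measure D" "sets D = sets borel" and M: "sets M = sets borel"
    and eq: "\<And>A. (\<And>i. A i \<in> sets borel) \<Longrightarrow> emeasure M {x. \<forall>i. x $ i \<in> A i} = (\<Prod>i\<in>UNIV. emeasure D (A i))"
  shows "M = distr (Pi\<^sub>M UNIV (\<lambda>_. D)) borel vec_lambda"
proof -
  interpret product_sigma_finite "\<lambda>_::'n. D"
    using D(1) by (simp add: product_sigma_finite_def)
  have [measurable_cong]: "sets M = sets borel" "sets D = sets borel" by fact+
  have spD: "space D = UNIV" using sets_eq_imp_space_eq[OF D(2)] by simp
  have spM: "space M = UNIV" using sets_eq_imp_space_eq[OF M] by simp
  have nth [measurable]: "vec_nth \<in> measurable M (Pi\<^sub>M UNIV (\<lambda>_. D))"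
    by (rule measurable_PiM_single') (auto simp: spD)
  have lam [measurable]: "vec_lambda \<in> borel_measurable (Pi\<^sub>M UNIV (\<lambda>_. D))"
    by (rule measurable_vec_lambda) measurable
  have "distr M (Pi\<^sub>M UNIV (\<lambda>_. D)) vec_nth = Pi\<^sub>M UNIV (\<lambda>_. D)"
  proof (rule PiM_eqI)
    fix A :: "'n \<Rightarrow> 'a set" assume A: "\<And>i. i \<in> UNIV \<Longrightarrow> A i \<in> sets D"
    then have "emeasure (distr M (Pi\<^sub>M UNIV (\<lambda>_. D)) vec_nth) (Pi\<^sub>E UNIV A)
        = emeasure M (vec_nth -` Pi\<^sub>E UNIV A \<inter> space M)"
      by (intro emeasure_distr nth sets_PiM_I_finite) auto
    also have "vec_nth -` Pi\<^sub>E UNIV A \<inter> space M = {x. \<forall>i. x $ i \<in> A i}"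
      by (auto simp: spM PiE_iff)
    also have "emeasure M \<dots> = (\<Prod>i\<in>UNIV. emeasure D (A i))"
      using A D(2) by (intro eq) auto
    finally show "emeasure (distr M (Pi\<^sub>M UNIV (\<lambda>_. D)) vec_nth) (Pi\<^sub>E UNIV A) = (\<Prod>i\<in>UNIV. emeasure D (A i))" .
  qed auto
  then have "distr (Pi\<^sub>M UNIV (\<lambda>_. D)) borel vec_lambda = distr (distr M (Pi\<^sub>M UNIV (\<lambda>_. D)) vec_nth) borel vec_lambda"
    by simp
  also have "\<dots> = distr M borel (\<lambda>x. x)"
    by (subst distr_distr) (auto simp: o_def)
  also have "\<dots> = M" using M[symmetric] by (rule distr_id2)
  finally show ?thesis ..
qed

definition vec_cmod_square :: "complex^'n \<Rightarrow> real^'n" where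
  "vec_cmod_square s = (\<chi> k. (cmod (s $ k))\<^sup>2)"

lemma measurable_vec_cmod_square [measurable]: "vec_cmod_square \<in> borel_measurable borel"
  unfolding vec_cmod_square_def[abs_def] by measurable

lemma indicator_all_vec:
  "indicator {x. \<forall>i. P i (x $ i)} (x::'a^'n) = (\<Prod>i\<in>UNIV. indicator {y. P i y} (x $ i) :: ennreal)"
  by (auto simp: indicator_def)

lemma borel_vec_pos [measurable]: "{u :: real^'n. \<forall>k. 0 < u $ k} \<in> sets borel"
  using borel_vec_box[of "\<lambda>_::'n. {0::real<..}"] by simp

text \<open>Both measures give a box the product of the masses of its sides under \<open>?D\<close>,
  the image of planar Lebesgue measure under the squared modulus; hence both equal the same product
  measure.\<close>

lemma distr_vec_cmod_square:
  "distr (lborel :: (complex^'n) measure) borel vec_cmod_square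
    = density lborel (\<lambda>u. ennreal (pi ^ CARD('n)) * indicator {u. \<forall>k. 0 < u $ k} u)"
  (is "?L = ?R")
proof -
  let ?D = "density lborel (\<lambda>x::real. ennreal (pi * indicator {0<..} x))"
  have D: "sigma_finite_measure ?D"
    by (subst sigma_finite_measure.sigma_finite_iff_density_finite[OF sigma_finite_lborel]) auto
  have "?L = distr (Pi\<^sub>M UNIV (\<lambda>_. ?D)) borel vec_lambda"
  proof (rule measure_eq_distr_PiM_vec[OF D])
    fix A :: "'n \<Rightarrow> real set" assume [measurable]: "\<And>i. A i \<in> sets borel"
    have box: "{x::real^'n. \<forall>i. x $ i \<in> A i} \<in> sets borel"
      by (rule borel_vec_box) simp
    have "emeasure ?L {x. \<forall>i. x $ i \<in> A i} = emeasure lborel {s :: complex^'n. \<forall>i. (cmod (s $ i))\<^sup>2 \<in> A i}"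
      using box by (subst emeasure_distr) (auto simp: vec_cmod_square_def vimage_def)
    also have "\<dots> = (\<integral>\<^sup>+s. indicator {s :: complex^'n. \<forall>i. (cmod (s $ i))\<^sup>2 \<in> A i} s \<partial>lborel)"
    proof (rule nn_integral_indicator[symmetric])
      have "vec_cmod_square -` {x. \<forall>i. x $ i \<in> A i} \<inter> space borel \<in> sets (borel :: (complex^'n) measure)"
        by (rule measurable_sets[OF measurable_vec_cmod_square box])
      then show "{s :: complex^'n. \<forall>i. (cmod (s $ i))\<^sup>2 \<in> A i} \<in> sets lborel"
        by (simp add: vec_cmod_square_def vimage_def)
    qed
    also have "\<dots> = (\<integral>\<^sup>+s. (\<Prod>i\<in>UNIV. indicator (A i) ((cmod (s $ i))\<^sup>2)) \<partial>(lborel :: (complex^'n) measure))"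
      by (intro nn_integral_cong) (subst indicator_all_vec[where P="\<lambda>i z. (cmod z)\<^sup>2 \<in> A i"], simp add: indicator_def)
    also have "\<dots> = (\<Prod>i\<in>UNIV. \<integral>\<^sup>+z. indicator (A i) ((cmod z)\<^sup>2) \<partial>(lborel :: complex measure))"
      by (rule nn_integral_lborel_vec_prod) measurable
    also have "\<dots> = (\<Prod>i\<in>UNIV. emeasure ?D (A i))"
      by (intro prod.cong refl) (simp add: nn_integral_cmod_square emeasure_density)
    finally show "emeasure ?L {x. \<forall>i. x $ i \<in> A i} = (\<Prod>i\<in>UNIV. emeasure ?D (A i))" .
  qed auto
  moreover have "?R = distr (Pi\<^sub>M UNIV (\<lambda>_. ?D)) borel vec_lambda"
  proof (rule measure_eq_distr_PiM_vec[OF D])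
    fix A :: "'n \<Rightarrow> real set" assume [measurable]: "\<And>i. A i \<in> sets borel"
    have box: "{x::real^'n. \<forall>i. x $ i \<in> A i} \<in> sets borel"
      by (rule borel_vec_box) simp
    have "emeasure ?R {x. \<forall>i. x $ i \<in> A i} = (\<integral>\<^sup>+u. ennreal (pi ^ CARD('n)) * indicator {u. \<forall>k. 0 < u $ k} u *
        indicator {x. \<forall>i. x $ i \<in> A i} u \<partial>lborel)"
      using box by (subst emeasure_density) auto
    also have "\<dots> = (\<integral>\<^sup>+u. (\<Prod>i\<in>UNIV. ennreal (pi * indicator {0<..} (u $ i)) * indicator (A i) (u $ i))
        \<partial>(lborel :: (real^'n) measure))"
    proof (rule nn_integral_cong)
      fix u :: "real^'n"
      have "ennreal (pi * indicator {0<..} (u $ i)) = ennreal pi * indicator {y. 0 < y} (u $ i)" for i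
        by (simp add: indicator_def)
      then show "ennreal (pi ^ CARD('n)) * indicator {u. \<forall>k. 0 < u $ k} u * indicator {x. \<forall>i. x $ i \<in> A i} u
          = (\<Prod>i\<in>UNIV. ennreal (pi * indicator {0<..} (u $ i)) * indicator (A i) (u $ i))"
        by (simp add: prod.distrib indicator_all_vec[where P="\<lambda>i y. 0 < y"] indicator_all_vec[where P="\<lambda>i y. y \<in> A i"]
            ennreal_power)
    qed
    also have "\<dots> = (\<Prod>i\<in>UNIV. \<integral>\<^sup>+x. ennreal (pi * indicator {0<..} x) * indicator (A i) x \<partial>lborel)"
      by (rule nn_integral_lborel_vec_prod) measurable
    also have "\<dots> = (\<Prod>i\<in>UNIV. emeasure ?D (A i))"
      by (intro prod.cong refl) (simp add: emeasure_density)
    finally show "emeasure ?R {x. \<forall>i. x $ i \<in> A i} = (\<Prod>i\<in>UNIV. emeasure ?D (A i))" .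
  qed auto
  ultimately show ?thesis by simp
qed

text \<open>The case \<open>r = 1\<close> is the general formula with index type
  \<open>unit\<close>; this removes the one-element index from the domain of integration.\<close>

lemma distr_lborel_vec_unit:
  "distr (lborel :: ('a::euclidean_space^unit) measure) borel (\<lambda>s. s $ ()) = lborel"
proof -
  have "distr (lborel :: ('a^unit) measure) borel (\<lambda>s. s $ ()) = distr (Pi\<^sub>M {()} (\<lambda>_. lborel :: 'a measure)) borel (\<lambda>x. x ())"
    unfolding lborel_vec_eq_distr_PiM UNIV_unit[symmetric]
    by (subst distr_distr) (auto simp: o_def)
  also have "\<dots> = distr (Pi\<^sub>M {()} (\<lambda>_. lborel :: 'a measure)) lborel (\<lambda>x. x ())"
    by (rule distr_cong) auto
  also have "\<dots> = lborel" by (rule lborel_PiM.distr_singleton)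
  finally show ?thesis .
qed

lemma distr_unit_vec_cmod_square:
  "distr (lborel :: (complex^'n^unit) measure) borel (\<lambda>s. vec_cmod_square (s $ ()))
    = density lborel (\<lambda>u. ennreal (pi ^ CARD('n)) * indicator {u. \<forall>k. 0 < u $ k} u)"
proof -
  have "distr (lborel :: (complex^'n^unit) measure) borel (\<lambda>s. vec_cmod_square (s $ ()))
      = distr (distr lborel borel (\<lambda>s. s $ ())) borel vec_cmod_square"
    by (subst distr_distr) (auto simp: o_def)
  then show ?thesis by (simp only: distr_lborel_vec_unit distr_vec_cmod_square)
qed

text \<open>The constant \<open>pi ^ (CARD('n) + CARD('m))\<close> produced here is what cancels the
  prefactor of the general formula when \<open>r = 1\<close>.\<close>

lemma distr_pair_cmod_square:
  "distr (lborel :: ((complex^'n^unit) \<times> (complex^'m^unit)) measure) borel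
      (\<lambda>(s, p). (vec_cmod_square (s $ ()), vec_cmod_square (p $ ())))
    = density lborel (\<lambda>x. ennreal (pi ^ (CARD('n) + CARD('m)) *
        indicator {(u, v). (\<forall>i. 0 < u $ i) \<and> (\<forall>j. 0 < v $ j)} x))"
proof -
  let ?d = "\<lambda>u. ennreal (pi ^ CARD('n)) * indicator {u. \<forall>k. 0 < u $ k} (u :: real^'n)"
  let ?e = "\<lambda>u. ennreal (pi ^ CARD('m)) * indicator {u. \<forall>k. 0 < u $ k} (u :: real^'m)"
  have sf: "sigma_finite_measure (density lborel ?e)"
    by (subst sigma_finite_measure.sigma_finite_iff_density_finite[OF sigma_finite_lborel]) (auto simp: indicator_def)
  have "distr (lborel :: ((complex^'n^unit) \<times> (complex^'m^unit)) measure) borel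
      (\<lambda>(s, p). (vec_cmod_square (s $ ()), vec_cmod_square (p $ ())))
      = distr (lborel \<Otimes>\<^sub>M lborel) (borel \<Otimes>\<^sub>M borel) (\<lambda>(s, p). (vec_cmod_square (s $ ()), vec_cmod_square (p $ ())))"
    by (simp only: lborel_prod borel_prod)
  also have "\<dots> = distr lborel borel (\<lambda>s. vec_cmod_square (s $ ())) \<Otimes>\<^sub>M distr lborel borel (\<lambda>p. vec_cmod_square (p $ ()))"
    by (rule pair_measure_distr[symmetric]) (auto simp: distr_unit_vec_cmod_square sf)
  also have "\<dots> = density lborel ?d \<Otimes>\<^sub>M density lborel ?e"
    by (simp only: distr_unit_vec_cmod_square)
  also have "\<dots> = density (lborel \<Otimes>\<^sub>M lborel) (\<lambda>(u, v). ?d u * ?e v)"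
    by (rule pair_measure_density) (auto simp: sf sigma_finite_lborel)
  also have "(\<lambda>(u, v). ?d u * ?e v) = (\<lambda>x. ennreal (pi ^ (CARD('n) + CARD('m)) *
        indicator {(u, v). (\<forall>i. 0 < u $ i) \<and> (\<forall>j. 0 < v $ j)} x))"
    by (auto simp: fun_eq_iff indicator_def power_add ennreal_mult)
  finally show ?thesis by (simp only: lborel_prod)
qed

subsection \<open>The expectation of the inverse determinants\<close>

lemma borel_measurable_matrix:
  fixes A :: "'w \<Rightarrow> complex^'n^'m"
  assumes "\<And>j k. (\<lambda>\<omega>. A \<omega> $ j $ k) \<in> borel_measurable M"
  shows "A \<in> borel_measurable M"
proof -
  have "A = (\<lambda>\<omega>. \<chi> j. \<chi> k. A \<omega> $ j $ k)" by (simp add: vec_eq_iff)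
  also have "\<dots> \<in> borel_measurable M" by (intro measurable_vec_lambda assms)
  finally show ?thesis .
qed

lemma expectation_gauss_phase:
  fixes A :: "'w \<Rightarrow> complex^'n^'m" and t :: "'r::finite \<Rightarrow> real"
  assumes "prob_space M" and f: "pos_prob_density f"
    and indep: "prob_space.indep_vars M (\<lambda>_. borel) (\<lambda>(j, k) \<omega>. A \<omega> $ j $ k) (UNIV :: ('m \<times> 'n) set)"
    and dist: "\<And>j k. distributed M lborel (\<lambda>\<omega>. A \<omega> $ j $ k) (\<lambda>a. ennreal (1 / pi * f ((cmod a)\<^sup>2)))"
  shows "prob_space.expectation M (\<lambda>\<omega>. gauss_phase t (A \<omega>) s p) =
    (\<Prod>j\<in>UNIV. \<Prod>k\<in>UNIV. G f ((cmod (\<Sum>l\<in>UNIV. of_real (t l) * s $ l $ k * p $ l $ j))\<^sup>2))"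
proof -
  interpret prob_space M by fact
  define z where "z i = (\<Sum>l\<in>UNIV. of_real (t l) * s $ l $ snd i * p $ l $ fst i)" for i
  define X where "X i \<omega> = exp (2 * \<i> * of_real (Re (A \<omega> $ fst i $ snd i * z i)))" for i \<omega>
  have [measurable]: "(\<lambda>\<omega>. A \<omega> $ j $ k) \<in> borel_measurable M" for j k
    using distributed_measurable[OF dist[of j k]] by simp
  have "indep_vars (\<lambda>_. borel) (\<lambda>i \<omega>. exp (2 * \<i> * of_real (Re ((case i of (j, k) \<Rightarrow> \<lambda>\<omega>. A \<omega> $ j $ k) \<omega> * z i))))
      (UNIV :: ('m \<times> 'n) set)"
    by (rule indep_vars_compose2[OF indep, where Y="\<lambda>i a. exp (2 * \<i> * of_real (Re (a * z i)))"]) measurable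
  then have indX: "indep_vars (\<lambda>_. borel) X UNIV"
    by (simp add: X_def[abs_def] case_prod_unfold)
  \<comment> \<open>Each factor has modulus one, hence is integrable on a probability space whatever
    the tails of \<open>f\<close>.\<close>
  have intX: "integrable M (X i)" for i
    by (rule integrable_const_bound[where B=1]) (auto simp: X_def[abs_def])
  have "gauss_phase t (A \<omega>) s p = (\<Prod>i\<in>UNIV. X i \<omega>)" for \<omega>
  proof -
    have "(\<Sum>j\<in>UNIV. \<Sum>k\<in>UNIV. A \<omega> $ j $ k * (\<Sum>l\<in>UNIV. of_real (t l) * s $ l $ k * p $ l $ j))
        = (\<Sum>i\<in>UNIV. A \<omega> $ fst i $ snd i * z i)"
      by (simp add: z_def sum.cartesian_product case_prod_unfold UNIV_Times_UNIV)
    then show ?thesis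
      unfolding gauss_phase_def X_def by (simp only: Re_sum of_real_sum sum_distrib_left exp_sum finite)
  qed
  then have "expectation (\<lambda>\<omega>. gauss_phase t (A \<omega>) s p) = (\<Prod>i\<in>UNIV. expectation (X i))"
    by (simp add: indep_vars_lebesgue_integral[OF _ indX intX])
  also have "\<dots> = (\<Prod>i\<in>UNIV. G f ((cmod (z i))\<^sup>2))"
    unfolding X_def[abs_def] by (intro prod.cong refl expectation_character_eq_G \<open>prob_space M\<close> f dist)
  also have "\<dots> = (\<Prod>j\<in>UNIV. \<Prod>k\<in>UNIV. G f ((cmod (\<Sum>l\<in>UNIV. of_real (t l) * s $ l $ k * p $ l $ j))\<^sup>2))"
    by (simp add: z_def prod.cartesian_product case_prod_unfold UNIV_Times_UNIV)
  finally show ?thesis .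
qed

lemma expectation_inverse_det:
  fixes A :: "'w \<Rightarrow> complex^'n^'m" and t :: "'r::finite \<Rightarrow> real"
  assumes "prob_space M" and f: "pos_prob_density f"
    and indep: "prob_space.indep_vars M (\<lambda>_. borel) (\<lambda>(j, k) \<omega>. A \<omega> $ j $ k) (UNIV :: ('m \<times> 'n) set)"
    and dist: "\<And>j k. distributed M lborel (\<lambda>\<omega>. A \<omega> $ j $ k) (\<lambda>a. ennreal (1 / pi * f ((cmod a)\<^sup>2)))"
  shows "prob_space.expectation M
      (\<lambda>\<omega>. inverse (\<Prod>l\<in>UNIV. det (mat 1 + (t l)\<^sup>2 *\<^sub>R (conj_transpose (A \<omega>) ** A \<omega>)))) =
    of_real (1 / pi ^ (CARD('r) * (CARD('n) + CARD('m)))) *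
    (\<integral>(s, p). of_real (exp (- (\<Sum>l\<in>UNIV. (norm (s $ l))\<^sup>2 + (norm (p $ l))\<^sup>2))) *
        (\<Prod>j\<in>UNIV. \<Prod>k\<in>UNIV. G f ((cmod (\<Sum>l\<in>UNIV. of_real (t l) * s $ l $ k * p $ l $ j))\<^sup>2))
      \<partial>(lborel :: ((complex^'n^'r) \<times> (complex^'m^'r)) measure))"
proof -
  interpret prob_space M by fact
  interpret pair_sigma_finite M "lborel :: ((complex^'n^'r) \<times> (complex^'m^'r)) measure" ..
  have A [measurable]: "A \<in> borel_measurable M"
    using distributed_measurable[OF dist] by (intro borel_measurable_matrix) simp
  define K where "K \<omega> x = (case x of (s :: complex^'n^'r, p :: complex^'m^'r) \<Rightarrow>
    of_real (gauss_weight s * gauss_weight p) * gauss_phase t (A \<omega>) s p)" for \<omega> x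
  let ?c = "complex_of_real (pi ^ (CARD('r) * (CARD('n) + CARD('m))))"
  have [measurable]: "(\<lambda>(s :: complex^'n^'r, p :: complex^'m^'r). gauss_weight s * gauss_weight p) \<in> borel_measurable lborel"
    using integrable_gauss_weight_pair by (rule borel_measurable_integrable)
  \<comment> \<open>The joint majorant is the constant 1 in \<open>\<omega>\<close> times the
    Gaussian weight in \<open>s\<close> and \<open>p\<close>.\<close>
  have intK: "integrable (M \<Otimes>\<^sub>M lborel) (\<lambda>(\<omega>, x). K \<omega> x)"
  proof (rule Bochner_Integration.integrable_bound)
    show "integrable (M \<Otimes>\<^sub>M lborel) (\<lambda>(\<omega>, x). 1 * (case x of (s :: complex^'n^'r, p :: complex^'m^'r) \<Rightarrow>
        gauss_weight s * gauss_weight p))"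
      by (intro integrable_pair_mult sigma_finite_lborel integrable_gauss_weight_pair)
        (auto intro: prob_space_imp_sigma_finite \<open>prob_space M\<close>)
    show "(\<lambda>(\<omega>, x). K \<omega> x) \<in> borel_measurable (M \<Otimes>\<^sub>M lborel)"
      unfolding K_def case_prod_unfold lborel_prod[symmetric] by measurable
  qed (auto simp: K_def norm_mult norm_gauss_phase case_prod_unfold)
  have c0: "?c \<noteq> 0" by simp
  \<comment> \<open>The Gaussian formula is read backwards, for each \<open>\<omega>\<close>: the
    inverse determinants are replaced by the double integral that represents them.\<close>
  have "expectation (\<lambda>\<omega>. inverse (\<Prod>l\<in>UNIV. det (mat 1 + (t l)\<^sup>2 *\<^sub>R (conj_transpose (A \<omega>) ** A \<omega>))))
      = expectation (\<lambda>\<omega>. inverse ?c * (\<integral>x. K \<omega> x \<partial>lborel))"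
    by (simp only: K_def integral_gauss_phase mult.assoc[symmetric] left_inverse[OF c0] mult_1_left)
  also have "\<dots> = inverse ?c * (\<integral>\<omega>. \<integral>x. K \<omega> x \<partial>lborel \<partial>M)"
    by (rule integral_mult_right_zero)
  also have "(\<integral>\<omega>. \<integral>x. K \<omega> x \<partial>lborel \<partial>M) = (\<integral>x. \<integral>\<omega>. K \<omega> x \<partial>M \<partial>lborel)"
    by (rule Fubini_integral[OF intK, symmetric])
  also have "\<dots> = (\<integral>(s, p). of_real (exp (- (\<Sum>l\<in>UNIV. (norm (s $ l))\<^sup>2 + (norm (p $ l))\<^sup>2))) *
        (\<Prod>j\<in>UNIV. \<Prod>k\<in>UNIV. G f ((cmod (\<Sum>l\<in>UNIV. of_real (t l) * s $ l $ k * p $ l $ j))\<^sup>2))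
      \<partial>(lborel :: ((complex^'n^'r) \<times> (complex^'m^'r)) measure))"
  proof (rule Bochner_Integration.integral_cong[OF refl], goal_cases)
    case (1 x)
    obtain s p where x: "x = (s, p)" by (cases x)
    have gw: "gauss_weight s * gauss_weight p = exp (- (\<Sum>l\<in>UNIV. (norm (s $ l))\<^sup>2 + (norm (p $ l))\<^sup>2))"
      by (simp add: gauss_weight_def sum.distrib exp_add[symmetric])
    show ?case
      unfolding x K_def prod.case integral_mult_right_zero expectation_gauss_phase[OF assms] gw ..
  qed
  finally show ?thesis by (simp add: divide_inverse)
qed

lemma expectation_inverse_det_single:
  fixes A :: "'w \<Rightarrow> complex^'n^'m" and \<tau> :: real
  assumes "prob_space M" and f: "pos_prob_density f"
    and indep: "prob_space.indep_vars M (\<lambda>_. borel) (\<lambda>(j, k) \<omega>. A \<omega> $ j $ k) (UNIV :: ('m \<times> 'n) set)"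
    and dist: "\<And>j k. distributed M lborel (\<lambda>\<omega>. A \<omega> $ j $ k) (\<lambda>a. ennreal (1 / pi * f ((cmod a)\<^sup>2)))"
  shows "prob_space.expectation M (\<lambda>\<omega>. inverse (det (mat 1 + \<tau>\<^sup>2 *\<^sub>R (conj_transpose (A \<omega>) ** A \<omega>)))) =
    (LINT (u, v) : {(u, v). (\<forall>i. 0 < u $ i) \<and> (\<forall>j. 0 < v $ j)} | (lborel :: ((real^'n) \<times> (real^'m)) measure).
      of_real ((\<Prod>i\<in>UNIV. exp (- u $ i)) * (\<Prod>j\<in>UNIV. exp (- v $ j))) *
      (\<Prod>k\<in>UNIV. \<Prod>l\<in>UNIV. G f (\<tau>\<^sup>2 * u $ k * v $ l)))"
proof -
  let ?P = "{(u, v). (\<forall>i. 0 < u $ i) \<and> (\<forall>j. 0 < v $ j)} :: ((real^'n) \<times> (real^'m)) set"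
  define N where "N = CARD('n) + CARD('m)"
  \<comment> \<open>A substitute for \<open>G f\<close> that agrees with it at nonnegative arguments
    and is visibly measurable on the whole line, as transferring the integral along
    \<open>?sq\<close> requires.\<close>
  define H where "H y = complex_of_real (LBINT x:{0<..}. f x * phi (x * y))" for y
  define g where "g x = indicator {0<..} x * f x" for x
  have "integrable lborel g"
    using f by (simp add: pos_prob_density_def set_integrable_def g_def[abs_def])
  then have [measurable]: "g \<in> borel_measurable borel" by auto
  have "H = (\<lambda>y. complex_of_real (\<integral>x. g x * phi (x * y) \<partial>lborel))"
    by (simp add: H_def[abs_def] set_lebesgue_integral_def g_def mult.assoc)
  also have "\<dots> \<in> borel_measurable borel" by measurable
  finally have [measurable]: "H \<in> borel_measurable borel" .
  define F where "F x = (case x of (u :: real^'n, v :: real^'m) \<Rightarrow>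
      of_real ((\<Prod>i\<in>UNIV. exp (- u $ i)) * (\<Prod>j\<in>UNIV. exp (- v $ j))) *
      (\<Prod>k\<in>UNIV. \<Prod>l\<in>UNIV. H (\<tau>\<^sup>2 * u $ k * v $ l)))" for x
  have [measurable]: "F \<in> borel_measurable borel"
    unfolding F_def[abs_def] case_prod_unfold borel_prod[symmetric] by measurable
  have P [measurable]: "?P \<in> sets borel"
  proof -
    have "?P = (\<Inter>i. {x. 0 < fst x $ i}) \<inter> (\<Inter>j. {x. 0 < snd x $ j})" by auto
    also have "\<dots> \<in> sets borel"
      by (intro borel_open open_Int open_INT ballI open_Collect_less continuous_intros) auto
    finally show ?thesis .
  qed
  let ?sq = "\<lambda>(s, p). (vec_cmod_square (s $ ()), vec_cmod_square (p $ ()))"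
  have sq [measurable]: "?sq \<in> measurable (lborel :: ((complex^'n^unit) \<times> (complex^'m^unit)) measure) borel"
    unfolding lborel_prod[symmetric] borel_prod[symmetric] by measurable
  have "prob_space.expectation M (\<lambda>\<omega>. inverse (det (mat 1 + \<tau>\<^sup>2 *\<^sub>R (conj_transpose (A \<omega>) ** A \<omega>)))) =
    of_real (1 / pi ^ N) * (\<integral>(s, p). of_real (exp (- (\<Sum>l\<in>UNIV. (norm (s $ l))\<^sup>2 + (norm (p $ l))\<^sup>2))) *
        (\<Prod>j\<in>UNIV. \<Prod>k\<in>UNIV. G f ((cmod (\<Sum>l\<in>UNIV. of_real \<tau> * s $ l $ k * p $ l $ j))\<^sup>2))
      \<partial>(lborel :: ((complex^'n^unit) \<times> (complex^'m^unit)) measure))"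
    \<comment> \<open>The general formula for the index type \<open>unit\<close> and the constant
      function \<open>\<tau>\<close>.\<close>
    using expectation_inverse_det[OF assms, of "\<lambda>_::unit. \<tau>"] by (simp add: N_def UNIV_unit)
  also have "(\<integral>(s, p). of_real (exp (- (\<Sum>l\<in>UNIV. (norm (s $ l))\<^sup>2 + (norm (p $ l))\<^sup>2))) *
        (\<Prod>j\<in>UNIV. \<Prod>k\<in>UNIV. G f ((cmod (\<Sum>l\<in>UNIV. of_real \<tau> * s $ l $ k * p $ l $ j))\<^sup>2))
      \<partial>(lborel :: ((complex^'n^unit) \<times> (complex^'m^unit)) measure)) = (\<integral>x. F (?sq x) \<partial>lborel)"
  proof (rule Bochner_Integration.integral_cong[OF refl], goal_cases)
    case (1 x)
    obtain s p where x: "x = (s, p)" by (cases x)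
    have G: "G f ((cmod (\<Sum>l\<in>UNIV. of_real \<tau> * s $ l $ k * p $ l $ j))\<^sup>2)
        = H (\<tau>\<^sup>2 * vec_cmod_square (s $ ()) $ k * vec_cmod_square (p $ ()) $ j)" for j k
      by (simp add: UNIV_unit H_def G_eq_integral_phi[OF f] norm_mult power_mult_distrib vec_cmod_square_def)
    have e: "exp (- (\<Sum>l\<in>UNIV. (norm (s $ l))\<^sup>2 + (norm (p $ l))\<^sup>2)) =
        (\<Prod>i\<in>UNIV. exp (- vec_cmod_square (s $ ()) $ i)) * (\<Prod>j\<in>UNIV. exp (- vec_cmod_square (p $ ()) $ j))"
      by (simp add: UNIV_unit vec_cmod_square_def norm_vec_square exp_sum[symmetric] sum_negf exp_add[symmetric])
    show ?case
      \<comment> \<open>The swap is needed because the general formula takes the product over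
        \<open>j\<close> outside, the special one over the index of \<open>u\<close>.\<close>
      unfolding x prod.case G e F_def prod.case by (subst prod.swap) (rule refl)
  qed
  also have "\<dots> = integral\<^sup>L (distr lborel borel ?sq) F"
    by (rule integral_distr[symmetric]) measurable
  also have "\<dots> = (\<integral>x. (pi ^ N * indicator ?P x) *\<^sub>R F x \<partial>lborel)"
    unfolding distr_pair_cmod_square N_def
  proof (rule integral_density)
    show "(\<lambda>x. pi ^ (CARD('n) + CARD('m)) * indicator ?P x) \<in> borel_measurable lborel"
      using P by measurable
    show "AE x in lborel. 0 \<le> pi ^ (CARD('n) + CARD('m)) * indicator ?P x"
      by (intro AE_I2 mult_nonneg_nonneg) (simp_all add: indicator_def)
  qed measurable
  \<comment> \<open>This power of \<open>pi\<close> cancels against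
    \<open>1 / pi ^ N\<close>.\<close>
  also have "\<dots> = of_real (pi ^ N) * (\<integral>x. indicator ?P x *\<^sub>R F x \<partial>lborel)"
    by (simp only: scaleR_scaleR[symmetric] integral_scaleR_right) (simp add: scaleR_conv_of_real)
  also have "(\<integral>x. indicator ?P x *\<^sub>R F x \<partial>lborel) =
      (LINT (u, v) : ?P | lborel. of_real ((\<Prod>i\<in>UNIV. exp (- u $ i)) * (\<Prod>j\<in>UNIV. exp (- v $ j))) *
      (\<Prod>k\<in>UNIV. \<Prod>l\<in>UNIV. G f (\<tau>\<^sup>2 * u $ k * v $ l)))"
    unfolding set_lebesgue_integral_def
  proof (rule Bochner_Integration.integral_cong[OF refl], goal_cases)
    case (1 x)
    obtain u v where x: "x = (u, v)" by (cases x)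
    \<comment> \<open>On the positive orthant the argument is nonnegative, so \<open>H\<close> turns
      back into \<open>G f\<close>; elsewhere the indicator makes both integrands zero.\<close>
    have "G f (\<tau>\<^sup>2 * u $ k * v $ l) = H (\<tau>\<^sup>2 * u $ k * v $ l)" if "(u, v) \<in> ?P" for k l
      using that by (simp add: H_def G_eq_integral_phi[OF f] less_imp_le)
    then show ?case
      unfolding x prod.case by (cases "(u, v) \<in> ?P") (simp_all only: F_def prod.case indicator_simps scaleR_zero_left not_False_eq_True)
  qed
  finally show ?thesis by simp
qed

text \<open>The dimensions and the number of factors are cardinalities of finite index types; types
  being inhabited, \<open>r \<ge> 1\<close> is built in.\<close>

theorem proposition2:
  fixes M :: "'w measure"
    and f :: "real \<Rightarrow> real"
    and A :: "'w \<Rightarrow> complex^'n^'m"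
    and t :: "'r::finite \<Rightarrow> real"
  assumes "prob_space M"
    and "pos_prob_density f"
    and "prob_space.indep_vars M (\<lambda>_. borel) (\<lambda>(j, k) \<omega>. A \<omega> $ j $ k) (UNIV :: ('m \<times> 'n) set)"
    and "\<And>j k. distributed M lborel (\<lambda>\<omega>. A \<omega> $ j $ k) (\<lambda>a. ennreal (1 / pi * f ((cmod a)^2)))"
    and "\<And>l. 0 < t l"
  shows
    "(\<forall>y\<ge>0. G f y = of_real (LBINT x:{0<..}. f x * phi (x * y))) \<and>
     (\<forall>x\<ge>0. phi x = bessel_J0 (2 * sqrt x)) \<and>
     prob_space.expectation M
         (\<lambda>\<omega>. inverse (\<Prod>l\<in>UNIV. det (mat 1 + (t l)^2 *\<^sub>R (conj_transpose (A \<omega>) ** A \<omega>)))) =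
       of_real (1 / pi ^ (CARD('r) * (CARD('n) + CARD('m)))) *
       (\<integral>(s, p).
          of_real (exp (- (\<Sum>l\<in>UNIV. (norm (s $ l))^2 + (norm (p $ l))^2))) *
          (\<Prod>j\<in>UNIV. \<Prod>k\<in>UNIV.
             G f ((cmod (\<Sum>l\<in>UNIV. of_real (t l) * s $ l $ k * p $ l $ j))^2))
        \<partial>(lborel :: ((complex^'n^'r) \<times> (complex^'m^'r)) measure)) \<and>
     (\<forall>\<tau>>0.
       prob_space.expectation M
         (\<lambda>\<omega>. inverse (det (mat 1 + \<tau>^2 *\<^sub>R (conj_transpose (A \<omega>) ** A \<omega>)))) =
       (LINT (u, v) : {(u, v). (\<forall>i. 0 < u $ i) \<and> (\<forall>j. 0 < v $ j)}
            | (lborel :: ((real^'n) \<times> (real^'m)) measure).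
          of_real ((\<Prod>i\<in>UNIV. exp (- u $ i)) * (\<Prod>j\<in>UNIV. exp (- v $ j))) *
          (\<Prod>k\<in>UNIV. \<Prod>l\<in>UNIV. G f (\<tau>^2 * u $ k * v $ l))))"
proof (intro conjI allI impI)
  fix y :: real
  assume "0 \<le> y"
  then show "G f y = of_real (LBINT x:{0<..}. f x * phi (x * y))"
    by (rule G_eq_integral_phi[OF assms(2)])
next
  fix x :: real
  assume "0 \<le> x"
  then show "phi x = bessel_J0 (2 * sqrt x)"
    by (rule phi_eq_bessel_J0)
qed (rule expectation_inverse_det[OF assms(1-4)], rule expectation_inverse_det_single[OF assms(1-4)])

end
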